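(* Let $\widetilde{H}$ be the affine Hecke algebra of type $C_2$ with $q^2\neq1$. Let $\epsilon\in\{1,-1\}$ and let $t\in T$ be a weight with $t|_Q=t_{\epsilon q,1}$. Let $\mathbb{C}v_{s_1t}$ and $\mathbb{C}v_{s_2s_1t}$ be the $1$-dimensional $\widetilde{H}_{\{2\}}$-modules given by $T_2v_{s_1t}=qv_{s_1t}$, $X^\lambda v_{s_1t}=(s_1t)(X^\lambda)v_{s_1t}$, and $T_2v_{s_2s_1t}=-q^{-1}v_{s_2s_1t}$, $X^\lambda v_{s_2s_1t}=(s_2s_1t)(X^\lambda)v_{s_2s_1t}$, and let $M=\widetilde{H}\otimes_{\widetilde{H}_{\{2\}}}\mathbb{C}v_{s_1t}$ and $N=\widetilde{H}\otimes_{\widetilde{H}_{\{2\}}}\mathbb{C}v_{s_2s_1t}$. Unless $\epsilon=-1$ and $q$ is a primitive sixth root of unity, or $\epsilon=1$ and $q$ is a primitive third root of unity, $M$ and $N$ are irreducible.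
   Context: The type $C_2$ root system has simple roots $\alpha_1,\alpha_2$ with $\langle\alpha_1,\alpha_2^\vee\rangle=-1$, $\langle\alpha_2,\alpha_1^\vee\rangle=-2$; $s_i\lambda=\lambda-\langle\lambda,\alpha_i^\vee\rangle\alpha_i$, and $W_0=\langle s_1,s_2\rangle$. Fundamental weights: $\omega_1=\alpha_1+\frac12\alpha_2$, $\omega_2=\alpha_1+\alpha_2$; $P=\mathbb{Z}\omega_1+\mathbb{Z}\omega_2$, $Q=\mathbb{Z}\alpha_1+\mathbb{Z}\alpha_2$. $X=\{X^\lambda\mid\lambda\in P\}$, $X^\lambda X^\mu=X^{\lambda+\mu}$. For $q\in\mathbb{C}^\times$, $\widetilde{H}$ is the $\mathbb{C}$-algebra generated by $T_1,T_2$ and $X^\lambda$ ($\lambda\in P$), with the group algebra $\mathbb{C}[X]$ a subalgebra, subject to $T_i^2=(q-q^{-1})T_i+1$, $T_1T_2T_1T_2=T_2T_1T_2T_1$, and $X^\lambda T_i=T_iX^{s_i\lambda}+(q-q^{-1})\frac{X^\lambda-X^{s_i\lambda}}{1-X^{-\alpha_i}}$. $\widetilde{H}_{\{i\}}$ is the subalgebra generated by $T_i$ and $\mathbb{C}[X]$. Weights are elements of $T=\mathrm{Hom}(X,\mathbb{C}^\times)$, with $W_0$-action $(wt)(X^\lambda)=t(X^{w^{-1}\lambda})$. For $t\in T$, $t|_Q$ denotes its restriction to $\{X^\lambda\mid\lambda\in Q\}$, and $t_{z,w}$ is the character of $\{X^\lambda\mid\lambda\in Q\}$ with $X^{\alpha_1}\mapsto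 z$, $X^{\alpha_2}\mapsto w$. *)

theory Defs
  imports
    Complex_Main
    "HOL-Algebra.Algebra"
    "HOL-Algebra.Algebraic_Closure_Type"
    "HOL-Library.Product_Plus"
begin

section \<open>The root system of type \<open>C\<^sub>2\<close>\<close>

datatype node = One | Two

text \<open>The weight \<open>m \<omega>\<^sub>1 + n \<omega>\<^sub>2\<close> is the pair \<open>(m, n)\<close>, so its values on the simple coroots are
  the two coordinates.\<close>

type_synonym weight = "int \<times> int"

definition zmul :: "int \<Rightarrow> weight \<Rightarrow> weight" where
  "zmul k \<nu> = (k * fst \<nu>, k * snd \<nu>)"

fun simple_root :: "node \<Rightarrow> weight" where
  "simple_root One = (2, -1)"
| "simple_root Two = (-2, 2)"

fun pairing :: "weight \<Rightarrow> node \<Rightarrow> int" where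
  "pairing \<nu> One = fst \<nu>"
| "pairing \<nu> Two = snd \<nu>"

definition reflection :: "node \<Rightarrow> weight \<Rightarrow> weight" where
  "reflection i \<nu> = \<nu> - zmul (pairing \<nu> i) (simple_root i)"

lemma cartan_matrix:
  "pairing (simple_root One) One = 2" "pairing (simple_root One) Two = -1"
  "pairing (simple_root Two) One = -2" "pairing (simple_root Two) Two = 2"
  by simp_all

lemma fundamental_weights:
  "zmul 2 (1, 0) = zmul 2 (simple_root One) + simple_root Two"
  "(0, 1) = simple_root One + simple_root Two"
  by (simp_all add: zmul_def)


section \<open>Weights of the affine Hecke algebra\<close>

text \<open>An element of \<open>Hom(X, \<complex>\<^sup>\<times>)\<close>, with \<open>X\<^sup>\<nu>\<close> identified with \<open>\<nu>\<close>.\<close>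

definition is_character :: "(weight \<Rightarrow> complex) \<Rightarrow> bool" where
  "is_character t \<longleftrightarrow> (\<forall>\<nu>. t \<nu> \<noteq> 0) \<and> (\<forall>\<nu> \<mu>. t (\<nu> + \<mu>) = t \<nu> * t \<mu>)"

text \<open>\<open>w\<close> is meant to be an element of the Weyl group, that is, a composition of reflections.\<close>

definition weyl_act :: "(weight \<Rightarrow> weight) \<Rightarrow> (weight \<Rightarrow> complex) \<Rightarrow> weight \<Rightarrow> complex" where
  "weyl_act w t = (\<lambda>\<nu>. t (Hilbert_Choice.inv w \<nu>))"

text \<open>\<open>t|\<^sub>Q = t\<^sub>z\<^sub>,\<^sub>w\<close>\<close>

definition restricts_on_roots :: "(weight \<Rightarrow> complex) \<Rightarrow> complex \<Rightarrow> complex \<Rightarrow> bool" where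
  "restricts_on_roots t z w \<longleftrightarrow>
     (\<forall>m n. t (zmul m (simple_root One) + zmul n (simple_root Two)) = z powi m * w powi n)"

definition primitive_root_of_unity :: "nat \<Rightarrow> complex \<Rightarrow> bool" where
  "primitive_root_of_unity n z \<longleftrightarrow> n > 0 \<and> z ^ n = 1 \<and> (\<forall>k. 0 < k \<and> k < n \<longrightarrow> z ^ k \<noteq> 1)"


section \<open>The affine Hecke algebra\<close>

subsection \<open>The free algebra on the generators\<close>

datatype gen = GenT node | GenX weight

text \<open>The free monoid on the generators, written additively because the convolution product
  of \<^typ>\<open>'a \<Rightarrow>\<^sub>0 'b\<close> uses addition of keys.\<close>

datatype word = Word (letters: "gen list")

instantiation word :: monoid_add
begin

definition zero_word :: word where "0 = Word []"

definition plus_word :: "word \<Rightarrow> word \<Rightarrow> word" where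
  "u + v = Word (letters u @ letters v)"

instance
  by standard (simp_all add: zero_word_def plus_word_def)

end

type_synonym free_alg = "word \<Rightarrow>\<^sub>0 complex"

definition gen :: "gen \<Rightarrow> free_alg" where
  "gen g = Poly_Mapping.single (Word [g]) 1"

definition scalar :: "complex \<Rightarrow> free_alg" where
  "scalar c = Poly_Mapping.single 0 c"

abbreviation tT :: "node \<Rightarrow> free_alg" where "tT i \<equiv> gen (GenT i)"

abbreviation tX :: "weight \<Rightarrow> free_alg" where "tX \<nu> \<equiv> gen (GenX \<nu>)"

subsection \<open>The group algebra of the weight lattice\<close>

type_synonym group_alg = "weight \<Rightarrow>\<^sub>0 complex"

abbreviation mon :: "weight \<Rightarrow> group_alg" where
  "mon \<nu> \<equiv> Poly_Mapping.single \<nu> 1"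

text \<open>The linear map with \<open>X\<^sup>\<nu> \<mapsto> tX \<nu>\<close>.\<close>

definition lift_group_alg :: "group_alg \<Rightarrow> free_alg" where
  "lift_group_alg f =
     (\<Sum>\<nu>\<in>Poly_Mapping.keys f. scalar (Poly_Mapping.lookup f \<nu>) * tX \<nu>)"

text \<open>The quotient \<open>(X\<^sup>\<nu> - X\<^bsup>s\<^sub>i \<nu>\<^esup>) / (1 - X\<^bsup>-\<alpha>\<^sub>i\<^esup>)\<close>, written out as a finite geometric sum;
  see \<open>demazure_quotient\<close> below.\<close>

definition demazure :: "node \<Rightarrow> weight \<Rightarrow> group_alg" where
  "demazure i \<nu> =
     (if pairing \<nu> i \<ge> 0
      then (\<Sum>k<nat (pairing \<nu> i). mon (\<nu> - zmul (int k) (simple_root i)))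
      else - (\<Sum>k<nat (- pairing \<nu> i). mon (\<nu> + zmul (int (Suc k)) (simple_root i))))"

lemma demazure_quotient:
  "demazure i \<nu> * (1 - mon (- simple_root i)) = mon \<nu> - mon (reflection i \<nu>)"
proof -
  let ?\<alpha> = "simple_root i"
  have shift: "mon \<mu> * (1 - mon (- ?\<alpha>)) = mon \<mu> - mon (\<mu> - ?\<alpha>)" for \<mu>
    by (simp add: algebra_simps mult_single)
  have pos: "(\<Sum>k<n. mon (\<nu> - zmul (int k) ?\<alpha>)) * (1 - mon (- ?\<alpha>)) =
      mon \<nu> - mon (\<nu> - zmul (int n) ?\<alpha>)" for n
  proof (induction n)
    case 0
    show ?case by (simp add: zmul_def flip: zero_prod_def)
  next
    case (Suc n)
    have "\<nu> - zmul (int n) ?\<alpha> - ?\<alpha> = \<nu> - zmul (int (Suc n)) ?\<alpha>"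
      by (simp add: prod_eq_iff zmul_def algebra_simps)
    then show ?case
      using Suc by (simp only: sum.lessThan_Suc distrib_right shift) simp
  qed
  have neg: "(\<Sum>k<n. mon (\<nu> + zmul (int (Suc k)) ?\<alpha>)) * (1 - mon (- ?\<alpha>)) =
      mon (\<nu> + zmul (int n) ?\<alpha>) - mon \<nu>" for n
  proof (induction n)
    case 0
    show ?case by (simp add: zmul_def flip: zero_prod_def)
  next
    case (Suc n)
    have "\<nu> + zmul (int (Suc n)) ?\<alpha> - ?\<alpha> = \<nu> + zmul (int n) ?\<alpha>"
      by (simp add: prod_eq_iff zmul_def algebra_simps)
    then show ?case
      using Suc by (simp only: sum.lessThan_Suc distrib_right shift) simp
  qed
  show ?thesis
  proof (cases "pairing \<nu> i \<ge> 0")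
    case True
    then show ?thesis
      by (simp add: demazure_def pos reflection_def)
  next
    case False
    then have "\<nu> + zmul (int (nat (- pairing \<nu> i))) ?\<alpha> = reflection i \<nu>"
      by (simp add: reflection_def prod_eq_iff zmul_def)
    with False show ?thesis
      by (simp only: demazure_def if_False minus_mult_left[symmetric] neg minus_diff_eq)
  qed
qed

subsection \<open>The quotient by the defining relations\<close>

text \<open>\<open>r \<in> hecke_relators q\<close> encodes the relation \<open>r = 0\<close>.\<close>

definition hecke_relators :: "complex \<Rightarrow> free_alg set" where
  "hecke_relators q =
     {tX 0 - 1}
     \<union> {tX (\<nu> + \<mu>) - tX \<nu> * tX \<mu> | \<nu> \<mu>. True}
     \<union> {tT i * tT i - (scalar (q - inverse q) * tT i + 1) | i. True}
     \<union> {tT One * tT Two * tT One * tT Two - tT Two * tT One * tT Two * tT One}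
     \<union> {tX \<nu> * tT i - (tT i * tX (reflection i \<nu>)
           + scalar (q - inverse q) * lift_group_alg (demazure i \<nu>)) | \<nu> i. True}"

definition hecke_ideal :: "complex \<Rightarrow> free_alg set" where
  "hecke_ideal q = genideal ring_of_type_algebra (hecke_relators q)"

definition hecke :: "complex \<Rightarrow> free_alg set ring" where
  "hecke q = ring_of_type_algebra Quot hecke_ideal q"

definition cls :: "complex \<Rightarrow> free_alg \<Rightarrow> free_alg set" where
  "cls q x = hecke_ideal q +>\<^bsub>ring_of_type_algebra\<^esub> x"

text \<open>The subalgebra generated by \<open>T\<^sub>i\<close> and \<open>\<complex>[X]\<close>; the scalars lie in \<open>\<complex>[X]\<close>.\<close>

definition hecke_sub :: "complex \<Rightarrow> node \<Rightarrow> free_alg set set" where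
  "hecke_sub q i =
     generate_ring (hecke q) (insert (cls q (tT i)) (range (\<lambda>f. cls q (lift_group_alg f))))"


section \<open>Modules over noncommutative rings\<close>

text \<open>The locale \<^locale>\<open>module\<close> requires a commutative ring of scalars.\<close>

locale left_module = R?: ring R + M?: abelian_group M
  for R :: "('r, 'x) ring_scheme" and M :: "('r, 'm, 'y) module_scheme" (structure) +
  assumes smult_closed:
      "\<lbrakk>a \<in> carrier R; x \<in> carrier M\<rbrakk> \<Longrightarrow> a \<odot>\<^bsub>M\<^esub> x \<in> carrier M"
    and smult_l_distr:
      "\<lbrakk>a \<in> carrier R; b \<in> carrier R; x \<in> carrier M\<rbrakk> \<Longrightarrow>
       (a \<oplus>\<^bsub>R\<^esub> b) \<odot>\<^bsub>M\<^esub> x = a \<odot>\<^bsub>M\<^esub> x \<oplus>\<^bsub>M\<^esub> b \<odot>\<^bsub>M\<^esub> x"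
    and smult_r_distr:
      "\<lbrakk>a \<in> carrier R; x \<in> carrier M; y \<in> carrier M\<rbrakk> \<Longrightarrow>
       a \<odot>\<^bsub>M\<^esub> (x \<oplus>\<^bsub>M\<^esub> y) = a \<odot>\<^bsub>M\<^esub> x \<oplus>\<^bsub>M\<^esub> a \<odot>\<^bsub>M\<^esub> y"
    and smult_assoc:
      "\<lbrakk>a \<in> carrier R; b \<in> carrier R; x \<in> carrier M\<rbrakk> \<Longrightarrow>
       (a \<otimes>\<^bsub>R\<^esub> b) \<odot>\<^bsub>M\<^esub> x = a \<odot>\<^bsub>M\<^esub> (b \<odot>\<^bsub>M\<^esub> x)"
    and smult_one:
      "x \<in> carrier M \<Longrightarrow> \<one>\<^bsub>R\<^esub> \<odot>\<^bsub>M\<^esub> x = x"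

definition irreducible_module ::
    "('r, 'x) ring_scheme \<Rightarrow> ('r, 'm, 'y) module_scheme \<Rightarrow> bool" where
  "irreducible_module R M \<longleftrightarrow>
     left_module R M \<and> carrier M \<noteq> {\<zero>\<^bsub>M\<^esub>} \<and>
     (\<forall>N. submodule N R M \<longrightarrow> N = {\<zero>\<^bsub>M\<^esub>} \<or> N = carrier M)"

text \<open>The tensor product \<open>R \<otimes>\<^sub>A V\<close> for a subring \<open>A\<close> of \<open>R\<close> and a left \<open>A\<close>-module \<open>V\<close>: the free
  abelian group on \<open>R \<times> V\<close> modulo the subgroup generated by the relations of biadditivity and
  \<open>A\<close>-balancedness, with \<open>R\<close> acting on the left factor.\<close>

definition tensor_relators ::
    "('r, 'x) ring_scheme \<Rightarrow> 'r set \<Rightarrow> ('r, 'v, 'y) module_scheme \<Rightarrow> ('r \<times> 'v \<Rightarrow>\<^sub>0 int) set"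
  where
  "tensor_relators R A V =
     {frag_of (r \<oplus>\<^bsub>R\<^esub> r', v) - (frag_of (r, v) + frag_of (r', v)) | r r' v.
        r \<in> carrier R \<and> r' \<in> carrier R \<and> v \<in> carrier V}
     \<union> {frag_of (r, v \<oplus>\<^bsub>V\<^esub> v') - (frag_of (r, v) + frag_of (r, v')) | r v v'.
        r \<in> carrier R \<and> v \<in> carrier V \<and> v' \<in> carrier V}
     \<union> {frag_of (r \<otimes>\<^bsub>R\<^esub> a, v) - frag_of (r, a \<odot>\<^bsub>V\<^esub> v) | r a v.
        r \<in> carrier R \<and> a \<in> A \<and> v \<in> carrier V}"

definition induced_module ::
    "('r, 'x) ring_scheme \<Rightarrow> 'r set \<Rightarrow> ('r, 'v, 'y) module_scheme
      \<Rightarrow> ('r, ('r \<times> 'v \<Rightarrow>\<^sub>0 int) set) module" where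
  "induced_module R A V =
     (let F = free_Abelian_group (carrier R \<times> carrier V);
          K = generate F (tensor_relators R A V)
      in \<lparr>carrier = carrier (F Mod K),
          monoid.mult = undefined, monoid.one = undefined,
          ring.zero = \<one>\<^bsub>F Mod K\<^esub>,
          ring.add = (\<otimes>\<^bsub>F Mod K\<^esub>),
          module.smult = (\<lambda>a S. \<Union>f\<in>S. K #>\<^bsub>F\<^esub> frag_extend (\<lambda>(r, v). frag_of (a \<otimes>\<^bsub>R\<^esub> r, v)) f)\<rparr>)"


section \<open>One-dimensional modules of the parabolic subalgebra\<close>

text \<open>\<open>V\<close> is \<open>\<complex>\<close> with a \<open>\<complex>\<close>-linear action of the subalgebra generated by \<open>T\<^sub>i\<close> and \<open>\<complex>[X]\<close> such that
  \<open>T\<^sub>i\<close> acts by \<open>\<tau>\<close> and \<open>X\<^sup>\<nu>\<close> by \<open>\<theta> \<nu>\<close>.\<close>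

definition is_one_dim_module ::
    "complex \<Rightarrow> node \<Rightarrow> complex \<Rightarrow> (weight \<Rightarrow> complex) \<Rightarrow> (free_alg set, complex) module \<Rightarrow> bool"
  where
  "is_one_dim_module q i \<tau> \<theta> V \<longleftrightarrow>
     left_module (hecke q\<lparr>carrier := hecke_sub q i\<rparr>) V \<and>
     carrier V = UNIV \<and> ring.add V = (+) \<and> ring.zero V = 0 \<and>
     (\<forall>c z. cls q (scalar c) \<odot>\<^bsub>V\<^esub> z = c * z) \<and>
     (\<forall>z. cls q (tT i) \<odot>\<^bsub>V\<^esub> z = \<tau> * z) \<and>
     (\<forall>\<nu> z. cls q (tX \<nu>) \<odot>\<^bsub>V\<^esub> z = \<theta> \<nu> * z)"

text \<open>These conditions determine the action of the subalgebra, so the choice only concerns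
  irrelevant parts of the record. If no such module exists the value is arbitrary; existence is
  not assumed here and has to be proved where it is needed.\<close>

definition one_dim_module ::
    "complex \<Rightarrow> node \<Rightarrow> complex \<Rightarrow> (weight \<Rightarrow> complex) \<Rightarrow> (free_alg set, complex) module" where
  "one_dim_module q i \<tau> \<theta> = (SOME V. is_one_dim_module q i \<tau> \<theta> V)"

end

theory Submission
  imports Defs
begin

text \<open>
  Put \<open>p = q - q\<^bsup>-1\<^esup>\<close>. The weights of \<open>M\<close> are \<open>t\<close> and \<open>s\<^sub>1 t\<close>, each of multiplicity two, since \<open>s\<^sub>2 t = t\<close>. The
  intertwiner \<open>T\<^sub>1 - p / (1 - X\<^bsup>-\<alpha>\<^sub>1\<^esup>)\<close> exchanges the two generalised weight spaces, and it is bijective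
  unless \<open>t(X\<^bsup>\<alpha>\<^sub>1\<^esup>) = \<epsilon> q\<close> is \<open>q\<^bsup>2\<^esup>\<close> or \<open>q\<^bsup>-2\<^esup>\<close>, that is, unless \<open>q\<^sup>3 = \<epsilon>\<close>, which is the excluded
  case. So a nonzero submodule meets both weight spaces. The space of weight \<open>t\<close> is an irreducible
  module of the rank one algebra of \<open>T\<^sub>2\<close>, because \<open>t(X\<^bsup>\<alpha>\<^sub>2\<^esup>) = 1\<close> is different from \<open>q\<^bsup>2\<^esup>\<close> and \<open>q\<^bsup>-2\<^esup>\<close>, and the
  submodule is everything.

  To make this rigorous from generators and relations, a representation \<open>E\<close> on \<open>\<complex>\<^sup>2 \<oplus> \<complex>\<^sup>2\<close> with
  these weight spaces is written down explicitly (locale \<open>special_weight\<close>). It contains a vector \<open>v\<close> of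
  weight \<open>s\<^sub>1 t\<close> with \<open>T\<^sub>2 v = q v\<close>. The line \<open>\<complex> v\<close> provides the one-dimensional module
  (\<open>one_dim_module_exists\<close>), and \<open>1 \<otimes> 1 \<mapsto> v\<close> extends to a map from \<open>M\<close> to \<open>E\<close> (\<open>tensor_eq_0_imp\<close>).
  By the relations \<open>M\<close> is spanned by four elements (\<open>inducing_left_ideal_span\<close>), whose images in \<open>E\<close> are
  linearly independent because \<open>q\<^sup>3 \<noteq> \<epsilon>\<close> (\<open>annihilator_v\<close>); so the map is injective. Every nonzero vector of \<open>E\<close>
  generates \<open>v\<close> (\<open>reaches_v\<close>), hence every nonzero element of \<open>M\<close> generates \<open>M\<close>
  (\<open>irreducible_induced\<close>).

  The relations depend on \<open>q\<close> only through \<open>q - q\<^bsup>-1\<^esup>\<close>, so the algebra is the same for \<open>q\<close> and for \<open>-q\<^bsup>-1\<^esup>\<close>.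
  This symmetry turns \<open>N\<close> into a module of the form \<open>M\<close>, with \<open>t\<close> replaced by \<open>s\<^sub>1 s\<^sub>2 s\<^sub>1 t\<close> and \<open>\<epsilon>\<close> by \<open>-\<epsilon>\<close>.
\<close>

section \<open>Actions of the free algebra\<close>

lemma poly_mapping_induct_single [case_names zero add single]:
  fixes f :: "'a \<Rightarrow>\<^sub>0 'b::ab_group_add"
  assumes "P 0" and "\<And>f g. P f \<Longrightarrow> P g \<Longrightarrow> P (f + g)"
    and "\<And>k c. P (Poly_Mapping.single k c)"
  shows "P f"
proof (induction f rule: update_induct)
  case const
  then show ?case by (rule assms(1))
next
  case (update f a b)
  have "Poly_Mapping.update a b f = f + Poly_Mapping.single a b"
    using update.hyps(1)
    by (intro poly_mapping_eqI)
       (auto simp: lookup_update lookup_add lookup_single when_def in_keys_iff)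
  with update show ?case by (simp add: assms)
qed

locale complex_space = vector_space scale
  for scale :: "complex \<Rightarrow> 'e::ab_group_add \<Rightarrow> 'e" (infixr \<open>*s\<close> 75)
begin

definition linext :: "('k \<Rightarrow> 'e) \<Rightarrow> ('k \<Rightarrow>\<^sub>0 complex) \<Rightarrow> 'e" where
  "linext c f = (\<Sum>k\<in>Poly_Mapping.keys f. Poly_Mapping.lookup f k *s c k)"

lemma linext_0 [simp]: "linext c 0 = 0"
  by (simp add: linext_def)

lemma linext_add: "linext c (f + g) = linext c f + linext c g"
  unfolding linext_def by (rule setsum_keys_plus_distrib) (simp_all add: scale_left_distrib)

lemma linext_single [simp]: "linext c (Poly_Mapping.single k a) = a *s c k"
  by (simp add: linext_def)

lemma linext_uminus: "linext c (- f) = - linext c f"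
  using linext_add[of c f "- f"] by (simp add: eq_neg_iff_add_eq_0 add.commute)

lemma linext_diff: "linext c (f - g) = linext c f - linext c g"
  using linext_add[of c f "- g"] by (simp add: linext_uminus)

lemma linext_fun_diff: "linext (\<lambda>k. c k - d k) f = linext c f - linext d f"
  by (simp add: linext_def scale_right_diff_distrib sum_subtractf)

lemma linext_shift:
  fixes c :: "'k::monoid_add \<Rightarrow> 'e"
  shows "linext c (f * Poly_Mapping.single b 1) = linext (\<lambda>k. c (k + b)) f"
  by (induction f rule: poly_mapping_induct_single)
     (simp_all add: linext_add distrib_right mult_single)

text \<open>The sum \<open>demazure i \<nu>\<close> telescopes whenever the summand is a difference along \<open>\<alpha>\<^sub>i\<close>. This evaluates
  it without any case distinction on the sign of the pairing, also on spaces where \<open>1 - X\<^bsup>-\<alpha>\<^esup>\<close>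
  is not invertible and the fraction defining the sum makes no sense.\<close>

lemma linext_demazure:
  assumes "\<And>\<mu>. c \<mu> = d \<mu> - d (\<mu> - simple_root i)"
  shows "linext c (demazure i \<nu>) = d \<nu> - d (reflection i \<nu>)"
proof -
  have "linext c (demazure i \<nu>) = linext d (demazure i \<nu> * (1 - mon (- simple_root i)))"
    by (simp add: right_diff_distrib linext_diff linext_shift linext_fun_diff[symmetric] assms[symmetric])
  then show ?thesis
    by (simp add: demazure_quotient linext_diff)
qed

end

locale free_algebra_action = complex_space scale
  for scale :: "complex \<Rightarrow> 'e::ab_group_add \<Rightarrow> 'e" (infixr \<open>*s\<close> 75) +
  fixes \<rho> :: "gen \<Rightarrow> 'e \<Rightarrow> 'e"
  assumes gen_add: "\<rho> g (x + y) = \<rho> g x + \<rho> g y"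
    and gen_scale: "\<rho> g (a *s x) = a *s \<rho> g x"
begin

definition word_act :: "word \<Rightarrow> 'e \<Rightarrow> 'e" where
  "word_act w = foldr \<rho> (letters w)"

lemma word_act_0 [simp]: "word_act 0 e = e"
  by (simp add: word_act_def zero_word_def)

lemma word_act_plus: "word_act (u + w) e = word_act u (word_act w e)"
  by (simp add: word_act_def plus_word_def)

lemma word_act_linear:
  "word_act w (x + y) = word_act w x + word_act w y"
  "word_act w (a *s x) = a *s word_act w x"
proof -
  have "foldr \<rho> l (x + y) = foldr \<rho> l x + foldr \<rho> l y
      \<and> foldr \<rho> l (a *s x) = a *s foldr \<rho> l x" for l
    by (induction l) (simp_all add: gen_add gen_scale)
  then show "word_act w (x + y) = word_act w x + word_act w y"
    "word_act w (a *s x) = a *s word_act w x"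
    by (simp_all add: word_act_def)
qed

definition act :: "free_alg \<Rightarrow> 'e \<Rightarrow> 'e" where
  "act x e = linext (\<lambda>w. word_act w e) x"

lemma act_left [simp]:
  "act 0 e = 0" "act (x + y) e = act x e + act y e"
  "act (- x) e = - act x e" "act (x - y) e = act x e - act y e"
  by (simp_all add: act_def linext_add linext_uminus linext_diff)

lemma act_single: "act (Poly_Mapping.single w a) e = a *s word_act w e"
  by (simp add: act_def)

lemma act_scalar [simp]: "act (scalar a) e = a *s e"
  by (simp add: scalar_def act_single)

lemma act_one [simp]: "act 1 e = e"
  using act_single[of 0 1 e] by simp

lemma act_gen [simp]: "act (gen g) e = \<rho> g e"
  by (simp add: gen_def act_single word_act_def)

lemma act_right:
  "act x (e + e') = act x e + act x e'" "act x (a *s e) = a *s act x e"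
  by (simp_all add: act_def linext_def word_act_linear scale_right_distrib sum.distrib
      scale_sum_right mult.commute)

lemma act_right_0 [simp]: "act x 0 = 0"
  using act_right(1)[of x 0 0] by simp

lemma act_mult [simp]: "act (x * y) e = act x (act y e)"
proof (induction x rule: poly_mapping_induct_single)
  case zero
  then show ?case by simp
next
  case (add f g)
  then show ?case by (simp add: distrib_right)
next
  case (single w a)
  show ?case
  proof (induction y rule: poly_mapping_induct_single)
    case zero
    then show ?case by simp
  next
    case (add f g)
    then show ?case by (simp add: distrib_left act_right)
  next
    case (single u b)
    show ?case
      by (simp add: mult_single act_single word_act_plus word_act_linear)
  qed
qed

lemma act_sum: "act (\<Sum>i\<in>I. f i) e = (\<Sum>i\<in>I. act (f i) e)"
  by (induction I rule: infinite_finite_induct) simp_all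

lemma act_lift_group_alg:
  "act (lift_group_alg f) e = linext (\<lambda>\<nu>. \<rho> (GenX \<nu>) e) f"
  by (simp add: lift_group_alg_def act_sum linext_def)

end

section \<open>The affine Hecke algebra as a quotient\<close>

abbreviation free_ring :: "free_alg ring" where
  "free_ring \<equiv> ring_of_type_algebra"

lemma free_ring_simps [simp]:
  "carrier free_ring = UNIV" "x \<oplus>\<^bsub>free_ring\<^esub> y = x + y"
  "x \<otimes>\<^bsub>free_ring\<^esub> y = x * y" "\<one>\<^bsub>free_ring\<^esub> = 1" "\<zero>\<^bsub>free_ring\<^esub> = 0"
  by (simp_all add: ring_of_type_algebra_def)

lemma ring_free_ring: "ring free_ring"
proof -
  have "\<exists>y. x + y = 0" for x :: free_alg
    using add.right_inverse by blast
  then show ?thesis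
    unfolding ring_of_type_algebra_def using add.right_inverse
    by unfold_locales (auto simp: algebra_simps Units_def)
qed

lemma free_ring_a_inv [simp]: "\<ominus>\<^bsub>free_ring\<^esub> x = - x"
proof -
  interpret ring free_ring by (rule ring_free_ring)
  show ?thesis
    using minus_equality[of "- x" x] by simp
qed

lemma ideal_hecke_ideal: "ideal (hecke_ideal q) free_ring"
  unfolding hecke_ideal_def by (rule ring.genideal_ideal[OF ring_free_ring]) simp

lemma hecke_relators_in_ideal: "x \<in> hecke_relators q \<Longrightarrow> x \<in> hecke_ideal q"
  using ring.genideal_self[OF ring_free_ring, of "hecke_relators q"]
  by (auto simp: hecke_ideal_def)

lemma hecke_ideal_minimal:
  assumes "ideal I free_ring" "hecke_relators q \<subseteq> I"
  shows "hecke_ideal q \<subseteq> I"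
  unfolding hecke_ideal_def by (rule ring.genideal_minimal[OF ring_free_ring assms])

lemma ring_hecke: "ring (hecke q)"
  unfolding hecke_def by (rule ideal.quotient_is_ring[OF ideal_hecke_ideal])

lemma cls_hom: "cls q \<in> ring_hom free_ring (hecke q)"
  unfolding hecke_def cls_def[abs_def] by (rule ideal.rcos_ring_hom[OF ideal_hecke_ideal])

lemma cls_simps:
  "cls q (x + y) = cls q x \<oplus>\<^bsub>hecke q\<^esub> cls q y"
  "cls q (x * y) = cls q x \<otimes>\<^bsub>hecke q\<^esub> cls q y"
  "cls q 1 = \<one>\<^bsub>hecke q\<^esub>"
  "cls q 0 = \<zero>\<^bsub>hecke q\<^esub>"
  "cls q (- x) = \<ominus>\<^bsub>hecke q\<^esub> cls q x"
proof -
  interpret h: ring_hom_ring free_ring "hecke q" "cls q"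
    using cls_hom ring_free_ring ring_hecke by (simp add: ring_hom_ringI2)
  show "cls q (x + y) = cls q x \<oplus>\<^bsub>hecke q\<^esub> cls q y"
    "cls q (x * y) = cls q x \<otimes>\<^bsub>hecke q\<^esub> cls q y"
    "cls q 1 = \<one>\<^bsub>hecke q\<^esub>" "cls q 0 = \<zero>\<^bsub>hecke q\<^esub>"
    "cls q (- x) = \<ominus>\<^bsub>hecke q\<^esub> cls q x"
    using h.hom_add[of x y] h.hom_mult[of x y] h.hom_one h.hom_zero h.hom_a_inv[of x] by simp_all
qed

lemma carrier_hecke: "carrier (hecke q) = range (cls q)"
  by (auto simp: hecke_def FactRing_def A_RCOSETS_def' cls_def)

lemma cls_closed [simp]: "cls q x \<in> carrier (hecke q)"
  by (simp add: carrier_hecke)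

lemma cls_eq_iff: "cls q x = cls q y \<longleftrightarrow> x - y \<in> hecke_ideal q"
proof -
  interpret ideal "hecke_ideal q" free_ring by (rule ideal_hecke_ideal)
  show ?thesis
    using quotient_eq_iff_same_a_r_cos[OF ideal_hecke_ideal, of x y]
    by (simp add: cls_def a_minus_def)
qed

section \<open>The tensor product over a subring\<close>

text \<open>The parts of the data of \<^const>\<open>induced_module\<close> on which its module structure depends: multiplication
  from the left maps the relators to relators as soon as \<open>R\<close> is a ring, while \<open>A\<close> and \<open>V\<close> only have
  to keep the relators inside the free group.\<close>

locale tensor_data = R?: ring R for R :: "('r, 'x) ring_scheme" (structure) +
  fixes A :: "'r set" and V :: "('r, 'v, 'y) module_scheme"
  assumes sub_carrier: "A \<subseteq> carrier R"
    and add_closed: "\<And>v w. v \<in> carrier V \<Longrightarrow> w \<in> carrier V \<Longrightarrow> v \<oplus>\<^bsub>V\<^esub> w \<in> carrier V"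
    and act_closed: "\<And>a v. a \<in> A \<Longrightarrow> v \<in> carrier V \<Longrightarrow> a \<odot>\<^bsub>V\<^esub> v \<in> carrier V"
begin

definition F :: "('r \<times> 'v \<Rightarrow>\<^sub>0 int) monoid" where
  "F = free_Abelian_group (carrier R \<times> carrier V)"

definition K :: "('r \<times> 'v \<Rightarrow>\<^sub>0 int) set" where
  "K = generate F (tensor_relators R A V)"

definition M :: "('r, ('r \<times> 'v \<Rightarrow>\<^sub>0 int) set) module" where
  "M = induced_module R A V"

definition ext :: "'r \<Rightarrow> ('r \<times> 'v \<Rightarrow>\<^sub>0 int) \<Rightarrow> ('r \<times> 'v \<Rightarrow>\<^sub>0 int)" where
  "ext a = frag_extend (\<lambda>(r, v). frag_of (a \<otimes> r, v))"

definition coset :: "('r \<times> 'v \<Rightarrow>\<^sub>0 int) \<Rightarrow> ('r \<times> 'v \<Rightarrow>\<^sub>0 int) set" where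
  "coset x = K #>\<^bsub>F\<^esub> x"

definition tensor :: "'r \<Rightarrow> 'v \<Rightarrow> ('r \<times> 'v \<Rightarrow>\<^sub>0 int) set" where
  "tensor r v = coset (frag_of (r, v))"

lemma F_simps [simp]:
  "x \<in> carrier F \<longleftrightarrow> Poly_Mapping.keys x \<subseteq> carrier R \<times> carrier V"
  "x \<otimes>\<^bsub>F\<^esub> y = x + y" "\<one>\<^bsub>F\<^esub> = 0"
  by (simp_all add: F_def)

lemma comm_group_F: "comm_group F"
  by (simp add: F_def abelian_free_Abelian_group)

lemma carrier_F_closed:
  "0 \<in> carrier F"
  "x \<in> carrier F \<Longrightarrow> y \<in> carrier F \<Longrightarrow> x + y \<in> carrier F"
  "x \<in> carrier F \<Longrightarrow> y \<in> carrier F \<Longrightarrow> x - y \<in> carrier F"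
  "r \<in> carrier R \<Longrightarrow> v \<in> carrier V \<Longrightarrow> frag_of (r, v) \<in> carrier F"
  using keys_add[of x y] keys_diff[of x y] by auto

lemma relator_cases [consumes 1, case_names add_left add_right balanced]:
  assumes "x \<in> tensor_relators R A V"
  obtains
    r r' v where "r \<in> carrier R" "r' \<in> carrier R" "v \<in> carrier V"
      "x = frag_of (r \<oplus> r', v) - (frag_of (r, v) + frag_of (r', v))"
  | r v v' where "r \<in> carrier R" "v \<in> carrier V" "v' \<in> carrier V"
      "x = frag_of (r, v \<oplus>\<^bsub>V\<^esub> v') - (frag_of (r, v) + frag_of (r, v'))"
  | r a v where "r \<in> carrier R" "a \<in> A" "v \<in> carrier V"
      "x = frag_of (r \<otimes> a, v) - frag_of (r, a \<odot>\<^bsub>V\<^esub> v)"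
  using assms unfolding tensor_relators_def Un_iff mem_Collect_eq
  by (elim disjE exE conjE) (rule that; assumption)+

lemma relatorI:
  "r \<in> carrier R \<Longrightarrow> r' \<in> carrier R \<Longrightarrow> v \<in> carrier V \<Longrightarrow>
     frag_of (r \<oplus> r', v) - (frag_of (r, v) + frag_of (r', v)) \<in> tensor_relators R A V"
  "r \<in> carrier R \<Longrightarrow> v \<in> carrier V \<Longrightarrow> v' \<in> carrier V \<Longrightarrow>
     frag_of (r, v \<oplus>\<^bsub>V\<^esub> v') - (frag_of (r, v) + frag_of (r, v')) \<in> tensor_relators R A V"
  "r \<in> carrier R \<Longrightarrow> a \<in> A \<Longrightarrow> v \<in> carrier V \<Longrightarrow>
     frag_of (r \<otimes> a, v) - frag_of (r, a \<odot>\<^bsub>V\<^esub> v) \<in> tensor_relators R A V"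
  unfolding tensor_relators_def Un_iff mem_Collect_eq by metis+

lemma relators_carrier: "tensor_relators R A V \<subseteq> carrier F"
proof
  fix x assume "x \<in> tensor_relators R A V"
  then show "x \<in> carrier F"
  proof (cases rule: relator_cases)
    case add_left
    then show ?thesis
      by (simp only:) (intro carrier_F_closed R.add.m_closed)
  next
    case add_right
    then show ?thesis
      by (simp only:) (intro carrier_F_closed add_closed)
  next
    case (balanced r a v)
    then have "a \<in> carrier R" using sub_carrier by blast
    with balanced show ?thesis
      by (simp only:) (intro carrier_F_closed R.m_closed act_closed)
  qed
qed

lemma subgroup_K: "subgroup K F"
  unfolding K_def
  using comm_group_F relators_carrier by (simp add: comm_group.axioms(2) group.generate_is_subgroup)

lemma inv_F: "x \<in> carrier F \<Longrightarrow> inv\<^bsub>F\<^esub> x = - x"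
  by (simp add: F_def)

lemma K_closed:
  "0 \<in> K" "x \<in> K \<Longrightarrow> y \<in> K \<Longrightarrow> x + y \<in> K" "x \<in> K \<Longrightarrow> - x \<in> K"
  "x \<in> K \<Longrightarrow> y \<in> K \<Longrightarrow> x - y \<in> K" "x \<in> K \<Longrightarrow> x \<in> carrier F"
proof -
  interpret subgroup K F by (rule subgroup_K)
  show 0: "0 \<in> K" "x \<in> K \<Longrightarrow> y \<in> K \<Longrightarrow> x + y \<in> K" "x \<in> K \<Longrightarrow> x \<in> carrier F"
    for x y
    using one_closed m_closed[of x y] subset by (simp_all del: F_simps(1) add: subsetD)
  show 1: "x \<in> K \<Longrightarrow> - x \<in> K" for x
    using m_inv_closed[of x] inv_F[of x] 0(3)[of x] by metis
  show "x \<in> K \<Longrightarrow> y \<in> K \<Longrightarrow> x - y \<in> K"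
    using 0(2)[of x "- y"] 1[of y] by simp
qed

lemma relator_in_K: "x \<in> tensor_relators R A V \<Longrightarrow> x \<in> K"
  unfolding K_def by (rule generate.incl)

lemma coset_altdef: "coset x = (\<lambda>k. k + x) ` K"
  by (auto simp: coset_def r_coset_def)

lemma coset_eq_iff: "coset x = coset y \<longleftrightarrow> x - y \<in> K"
proof
  assume "coset x = coset y"
  moreover have "x \<in> coset x"
    using K_closed(1) by (force simp: coset_altdef)
  ultimately show "x - y \<in> K"
    by (auto simp: coset_altdef)
next
  have *: "coset x \<subseteq> coset y" if "x - y \<in> K" for x y
  proof
    fix z assume "z \<in> coset x"
    then obtain k where "k \<in> K" "z = k + x"
      by (auto simp: coset_altdef)
    then show "z \<in> coset y"
      using K_closed(2)[OF \<open>k \<in> K\<close> that]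
      by (auto simp: coset_altdef intro!: image_eqI[of _ _ "k + (x - y)"])
  qed
  assume "x - y \<in> K"
  then show "coset x = coset y"
    using *[of x y] *[of y x] K_closed(3)[of "x - y"] by auto
qed

lemma carrier_M: "carrier M = coset ` carrier F"
  by (simp add: M_def induced_module_def Let_def carrier_FactGroup coset_def K_def F_def)

lemma zero_M: "\<zero>\<^bsub>M\<^esub> = coset 0"
  by (simp add: M_def induced_module_def Let_def coset_altdef K_def F_def)

lemma add_M:
  assumes "x \<in> carrier F" "y \<in> carrier F"
  shows "coset x \<oplus>\<^bsub>M\<^esub> coset y = coset (x + y)"
proof -
  have "coset x \<oplus>\<^bsub>M\<^esub> coset y = coset x <#>\<^bsub>F\<^esub> coset y"
    by (simp add: M_def induced_module_def Let_def F_def)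
  also have "\<dots> = coset (x + y)"
    unfolding coset_def
    using normal.rcos_sum[OF comm_group.subgroup_imp_normal[OF comm_group_F subgroup_K] assms]
    by simp
  finally show ?thesis .
qed

lemma abelian_group_M: "abelian_group M"
proof (rule abelian_groupI)
  fix x assume "x \<in> carrier M"
  then obtain f where f: "f \<in> carrier F" "x = coset f"
    by (auto simp: carrier_M)
  have "- f \<in> carrier F"
    using carrier_F_closed(3)[OF carrier_F_closed(1) f(1)] by simp
  with f show "\<exists>y\<in>carrier M. y \<oplus>\<^bsub>M\<^esub> x = \<zero>\<^bsub>M\<^esub>"
    by (intro bexI[of _ "coset (- f)"]) (simp_all add: add_M zero_M carrier_M del: F_simps(1))
qed (auto simp add: carrier_M add_M zero_M carrier_F_closed ac_simps
       simp del: F_simps(1))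

lemma ext_simps [simp]:
  "ext a 0 = 0" "ext a (x + y) = ext a x + ext a y" "ext a (- x) = - ext a x"
  "ext a (x - y) = ext a x - ext a y" "ext a (frag_of (r, v)) = frag_of (a \<otimes> r, v)"
  by (simp_all add: ext_def frag_extend_add frag_extend_minus frag_extend_diff)

lemma F_induct [consumes 1, case_names zero one diff]:
  assumes "x \<in> carrier F" "P 0"
    "\<And>r v. r \<in> carrier R \<Longrightarrow> v \<in> carrier V \<Longrightarrow> P (frag_of (r, v))"
    "\<And>x y. P x \<Longrightarrow> P y \<Longrightarrow> P (x - y)"
  shows "P x"
proof -
  have "Poly_Mapping.keys x \<subseteq> carrier R \<times> carrier V"
    using assms(1) by simp
  then show ?thesis
    by (induction x rule: frag_induction) (use assms in auto)
qed

lemma ext_carrier: 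
  assumes "x \<in> carrier F" "a \<in> carrier R"
  shows "ext a x \<in> carrier F"
  using assms(1)
proof (induction x rule: F_induct)
  case (diff x y)
  then show ?case unfolding ext_simps by (rule carrier_F_closed)
qed (use assms(2) in auto)

text \<open>Left multiplication acts on the first factor and commutes with the right multiplication that the
  balancing relators involve, so it descends to the quotient.\<close>

lemma ext_relator:
  assumes a: "a \<in> carrier R" and "x \<in> tensor_relators R A V"
  shows "ext a x \<in> tensor_relators R A V"
  using assms(2)
proof (cases rule: relator_cases)
  case (add_left r r' v)
  then show ?thesis
    using relatorI(1)[of "a \<otimes> r" "a \<otimes> r'" v] a by (simp add: R.r_distr)
next
  case (add_right r v v')
  then show ?thesis
    using relatorI(2)[of "a \<otimes> r" v v'] a by simp
next
  case (balanced r b v)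
  then have "b \<in> carrier R" using sub_carrier by blast
  with balanced show ?thesis
    using relatorI(3)[of "a \<otimes> r" b v] a by (simp add: R.m_assoc)
qed

lemma K_induct [consumes 1, case_names zero relator uminus add]:
  assumes "x \<in> K" "P 0" "\<And>x. x \<in> tensor_relators R A V \<Longrightarrow> P x"
    "\<And>x. P x \<Longrightarrow> P (- x)" "\<And>x y. P x \<Longrightarrow> P y \<Longrightarrow> P (x + y)"
  shows "P x"
  using assms(1) unfolding K_def
proof (induction x rule: generate.induct)
  case (inv h)
  then show ?case
    using relators_carrier assms(3,4) by (metis inv_F subsetD)
qed (use assms in simp_all)

lemma ext_K:
  assumes "a \<in> carrier R" "x \<in> K"
  shows "ext a x \<in> K"
  using assms(2) by (induction x rule: K_induct)
     (auto intro: K_closed relator_in_K ext_relator assms(1))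

lemma smult_M:
  assumes "a \<in> carrier R"
  shows "a \<odot>\<^bsub>M\<^esub> coset x = coset (ext a x)"
proof -
  have "a \<odot>\<^bsub>M\<^esub> coset x = (\<Union>f\<in>coset x. coset (ext a f))"
    by (simp add: M_def induced_module_def Let_def coset_def ext_def[symmetric] K_def F_def)
  also have "\<dots> = (\<Union>f\<in>coset x. coset (ext a x))"
    using ext_K[OF assms] by (intro SUP_cong refl) (auto simp: coset_altdef[of x] coset_eq_iff)
  also have "\<dots> = coset (ext a x)"
    using K_closed(1) by (auto simp: coset_altdef)
  finally show ?thesis .
qed

lemma tensor_add_left:
  assumes "r \<in> carrier R" "r' \<in> carrier R" "v \<in> carrier V"
  shows "frag_of (r \<oplus> r', v) - (frag_of (r, v) + frag_of (r', v)) \<in> K"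
  using assms by (intro relator_in_K relatorI)

lemma ext_add_scalar:
  assumes "a \<in> carrier R" "b \<in> carrier R" "x \<in> carrier F"
  shows "ext (a \<oplus> b) x - (ext a x + ext b x) \<in> K"
  using assms(3)
proof (induction x rule: F_induct)
  case zero
  then show ?case by (simp add: K_closed)
next
  case (one r v)
  then show ?case
    using assms tensor_add_left[of "a \<otimes> r" "b \<otimes> r" v] by (simp add: R.l_distr)
next
  case (diff x y)
  then show ?case
    using K_closed(4)[OF diff] by (simp add: algebra_simps)
qed

lemma left_module_M: "left_module R M"
proof -
  interpret M: abelian_group M by (rule abelian_group_M)
  show ?thesis
  proof
    fix a b x y
    assume a: "a \<in> carrier R" and b: "b \<in> carrier R"
      and "x \<in> carrier M" "y \<in> carrier M"
    then obtain f g where f: "f \<in> carrier F" "x = coset f" and g: "g \<in> carrier F" "y = coset g"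
      by (auto simp: carrier_M)
    show "a \<odot>\<^bsub>M\<^esub> x \<in> carrier M"
      using ext_carrier[OF f(1) a] by (auto simp: f smult_M a carrier_M)
    show "(a \<oplus> b) \<odot>\<^bsub>M\<^esub> x = a \<odot>\<^bsub>M\<^esub> x \<oplus>\<^bsub>M\<^esub> b \<odot>\<^bsub>M\<^esub> x"
      using ext_add_scalar[OF a b f(1)] a b f(1)
      by (simp add: f(2) smult_M add_M ext_carrier coset_eq_iff del: F_simps)
    show "a \<odot>\<^bsub>M\<^esub> (x \<oplus>\<^bsub>M\<^esub> y) = a \<odot>\<^bsub>M\<^esub> x \<oplus>\<^bsub>M\<^esub> a \<odot>\<^bsub>M\<^esub> y"
      using a f(1) g(1) by (simp add: f(2) g(2) smult_M add_M ext_carrier del: F_simps)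
    have "ext (a \<otimes> b) f = ext a (ext b f)"
      using f(1) by (induction f rule: F_induct) (simp_all add: a b R.m_assoc)
    then show "(a \<otimes> b) \<odot>\<^bsub>M\<^esub> x = a \<odot>\<^bsub>M\<^esub> (b \<odot>\<^bsub>M\<^esub> x)"
      by (simp add: f(2) smult_M a b)
  next
    fix x assume "x \<in> carrier M"
    then obtain f where f: "f \<in> carrier F" "x = coset f"
      by (auto simp: carrier_M)
    have "ext \<one> f = f"
      using f(1) by (induction f rule: F_induct) simp_all
    then show "\<one> \<odot>\<^bsub>M\<^esub> x = x"
      by (simp add: f(2) smult_M)
  qed
qed

lemma tensor_closed: "r \<in> carrier R \<Longrightarrow> v \<in> carrier V \<Longrightarrow> tensor r v \<in> carrier M"
  unfolding tensor_def carrier_M by (intro imageI carrier_F_closed)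

lemma smult_tensor: "a \<in> carrier R \<Longrightarrow> a \<odot>\<^bsub>M\<^esub> tensor r v = tensor (a \<otimes> r) v"
  by (simp add: tensor_def smult_M)

lemma tensor_balanced:
  assumes "r \<in> carrier R" "a \<in> A" "v \<in> carrier V"
  shows "tensor (r \<otimes> a) v = tensor r (a \<odot>\<^bsub>V\<^esub> v)"
  unfolding tensor_def coset_eq_iff
  using assms by (intro relator_in_K relatorI)

text \<open>Since tensors add in the first factor, one vector \<open>v\<close> generates as soon as every pure tensor
  can be moved onto \<open>v\<close>.\<close>

lemma M_eq_multiples:
  assumes gen: "\<And>r w. r \<in> carrier R \<Longrightarrow> w \<in> carrier V \<Longrightarrow> \<exists>a\<in>carrier R. tensor r w = tensor a v"
    and v: "v \<in> carrier V" and m: "m \<in> carrier M"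
  shows "\<exists>a\<in>carrier R. m = tensor a v"
proof -
  obtain f where f: "f \<in> carrier F" "m = coset f"
    using m by (auto simp: carrier_M)
  from f(1) have "f \<in> carrier F \<and> (\<exists>a\<in>carrier R. coset f = tensor a v)"
  proof (induction f rule: F_induct)
    case zero
    have "frag_of (\<zero>, v) \<in> K"
      using K_closed(3)[OF tensor_add_left[of \<zero> \<zero> v]] v by simp
    then have "coset 0 = tensor \<zero> v"
      using K_closed(3)[of "frag_of (\<zero>, v)"] by (simp add: tensor_def coset_eq_iff)
    then show ?case by (auto intro!: carrier_F_closed)
  next
    case (one r w)
    then show ?case using gen[of r w] by (auto simp: tensor_def)
  next
    case (diff x y)
    then obtain a b where ab: "a \<in> carrier R" "b \<in> carrier R" "x - frag_of (a, v) \<in> K"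
      "y - frag_of (b, v) \<in> K"
      by (auto simp: tensor_def coset_eq_iff)
    have "a = (a \<ominus> b) \<oplus> b"
      using ab by (simp add: R.minus_eq R.a_assoc R.l_neg)
    then have "frag_of (a, v) - (frag_of (a \<ominus> b, v) + frag_of (b, v)) \<in> K"
      using tensor_add_left[of "a \<ominus> b" b v] ab v by simp
    from K_closed(2)[OF K_closed(4)[OF ab(3,4)] this]
    have "coset (x - y) = tensor (a \<ominus> b) v"
      by (simp add: tensor_def coset_eq_iff algebra_simps)
    then show ?case
      using diff ab by (auto intro!: carrier_F_closed simp del: F_simps)
  qed
  then show ?thesis by (simp add: f(2))
qed

end

section \<open>Left modules, scalars and the parabolic subalgebra\<close>

context left_module
begin

lemma smult_diff_eq_zero_iff:
  assumes "a \<in> carrier R" "b \<in> carrier R" "x \<in> carrier M"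
  shows "(a \<ominus>\<^bsub>R\<^esub> b) \<odot>\<^bsub>M\<^esub> x = \<zero>\<^bsub>M\<^esub> \<longleftrightarrow> a \<odot>\<^bsub>M\<^esub> x = b \<odot>\<^bsub>M\<^esub> x"
proof -
  have "a = (a \<ominus>\<^bsub>R\<^esub> b) \<oplus>\<^bsub>R\<^esub> b"
    using assms by (simp add: R.minus_eq R.a_assoc R.l_neg)
  then have "a \<odot>\<^bsub>M\<^esub> x = (a \<ominus>\<^bsub>R\<^esub> b) \<odot>\<^bsub>M\<^esub> x \<oplus>\<^bsub>M\<^esub> b \<odot>\<^bsub>M\<^esub> x"
    using assms smult_l_distr[of "a \<ominus>\<^bsub>R\<^esub> b" b x] by simp
  then show ?thesis
    using assms smult_closed[of "a \<ominus>\<^bsub>R\<^esub> b" x] smult_closed[of b x]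
      M.add.r_cancel_one[of "b \<odot>\<^bsub>M\<^esub> x" "(a \<ominus>\<^bsub>R\<^esub> b) \<odot>\<^bsub>M\<^esub> x"]
    by simp
qed

lemma zero_smult: "x \<in> carrier M \<Longrightarrow> \<zero>\<^bsub>R\<^esub> \<odot>\<^bsub>M\<^esub> x = \<zero>\<^bsub>M\<^esub>"
  using smult_diff_eq_zero_iff[of "\<zero>\<^bsub>R\<^esub>" "\<zero>\<^bsub>R\<^esub>" x] by (simp add: R.minus_eq)

lemma smult_zero: "a \<in> carrier R \<Longrightarrow> a \<odot>\<^bsub>M\<^esub> \<zero>\<^bsub>M\<^esub> = \<zero>\<^bsub>M\<^esub>"
  using smult_r_distr[of a "\<zero>\<^bsub>M\<^esub>" "\<zero>\<^bsub>M\<^esub>"] smult_closed[of a "\<zero>\<^bsub>M\<^esub>"]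
    M.add.l_cancel_one'[of "a \<odot>\<^bsub>M\<^esub> \<zero>\<^bsub>M\<^esub>" "a \<odot>\<^bsub>M\<^esub> \<zero>\<^bsub>M\<^esub>"]
  by simp

end

lemma scalar_simps:
  "scalar 0 = 0" "scalar 1 = 1" "scalar (a + b) = scalar a + scalar b"
  "scalar (a * b) = scalar a * scalar b" "scalar (- a) = - scalar a"
  "scalar (a - b) = scalar a - scalar b"
  by (simp_all add: scalar_def single_add mult_single single_uminus single_diff)

lemma scalar_commute: "x * scalar a = scalar a * x"
  by (induction x rule: poly_mapping_induct_single)
     (simp_all add: scalar_def distrib_left distrib_right mult_single mult.commute)

lemma lift_group_alg_add: "lift_group_alg (f + g) = lift_group_alg f + lift_group_alg g"
  unfolding lift_group_alg_def
  by (rule setsum_keys_plus_distrib) (simp_all add: scalar_simps distrib_right)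

lemma lift_group_alg_single [simp]: "lift_group_alg (Poly_Mapping.single \<nu> a) = scalar a * tX \<nu>"
  by (simp add: lift_group_alg_def scalar_simps)

lemma lift_group_alg_0 [simp]: "lift_group_alg 0 = 0"
  by (simp add: lift_group_alg_def)

lemma hecke_relatorI:
  "tX 0 - 1 \<in> hecke_relators q"
  "tX (\<nu> + \<mu>) - tX \<nu> * tX \<mu> \<in> hecke_relators q"
  "tT i * tT i - (scalar (q - inverse q) * tT i + 1) \<in> hecke_relators q"
  "tT One * tT Two * tT One * tT Two - tT Two * tT One * tT Two * tT One \<in> hecke_relators q"
  "tX \<nu> * tT i - (tT i * tX (reflection i \<nu>)
     + scalar (q - inverse q) * lift_group_alg (demazure i \<nu>)) \<in> hecke_relators q"
  unfolding hecke_relators_def by blast+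

lemma ideal_free_ringI:
  assumes "0 \<in> I" "\<And>x y. x \<in> I \<Longrightarrow> y \<in> I \<Longrightarrow> x + y \<in> I"
    and "\<And>x y. x \<in> I \<Longrightarrow> y * x \<in> I" "\<And>x y. x \<in> I \<Longrightarrow> x * y \<in> I"
  shows "ideal I free_ring"
proof (rule idealI)
  interpret ring free_ring by (rule ring_free_ring)
  show "ring free_ring" by (rule ring_free_ring)
  show "subgroup I (add_monoid free_ring)"
    using assms(1,2) assms(3)[of _ "- 1"]
    by (intro add.subgroupI) (auto simp flip: a_inv_def)
qed (use assms in simp_all)

lemma hecke_ideal_closed:
  "x \<in> hecke_ideal q \<Longrightarrow> y \<in> hecke_ideal q \<Longrightarrow> x + y \<in> hecke_ideal q"
  "x \<in> hecke_ideal q \<Longrightarrow> y * x \<in> hecke_ideal q"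
  "x \<in> hecke_ideal q \<Longrightarrow> x * y \<in> hecke_ideal q"
proof -
  interpret ideal "hecke_ideal q" free_ring by (rule ideal_hecke_ideal)
  show "x \<in> hecke_ideal q \<Longrightarrow> y \<in> hecke_ideal q \<Longrightarrow> x + y \<in> hecke_ideal q"
    using additive_subgroup.a_closed[OF is_additive_subgroup, of x y] by simp
  show "x \<in> hecke_ideal q \<Longrightarrow> y * x \<in> hecke_ideal q" "x \<in> hecke_ideal q \<Longrightarrow> x * y \<in> hecke_ideal q"
    using I_l_closed[of x y] I_r_closed[of x y] by simp_all
qed

lemma hecke_sub_carrier: "hecke_sub q i \<subseteq> carrier (hecke q)"
  unfolding hecke_sub_def by (rule ring.generate_ring_incl[OF ring_hecke]) auto

lemma ring_hecke_sub: "ring (hecke q\<lparr>carrier := hecke_sub q i\<rparr>)"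
  unfolding hecke_sub_def by (rule ring.generate_ring_is_ring[OF ring_hecke]) auto

lemma hecke_sub_closed:
  "\<one>\<^bsub>hecke q\<^esub> \<in> hecke_sub q i"
  "a \<in> hecke_sub q i \<Longrightarrow> b \<in> hecke_sub q i \<Longrightarrow> a \<oplus>\<^bsub>hecke q\<^esub> b \<in> hecke_sub q i"
  "a \<in> hecke_sub q i \<Longrightarrow> b \<in> hecke_sub q i \<Longrightarrow> a \<otimes>\<^bsub>hecke q\<^esub> b \<in> hecke_sub q i"
  "cls q (tT i) \<in> hecke_sub q i"
  "cls q (lift_group_alg f) \<in> hecke_sub q i"
  unfolding hecke_sub_def by (auto intro: generate_ring.intros)

text \<open>The subalgebra is generated by \<open>T\<^sub>i\<close> and the image of \<open>\<complex>[X]\<close> only; it contains the scalars because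
  \<open>X\<^sup>0 = 1\<close>.\<close>

lemma cls_scalar_X: "cls q (scalar a * tX 0) = cls q (scalar a)"
proof -
  have "tX 0 - 1 \<in> hecke_ideal q"
    by (intro hecke_relators_in_ideal hecke_relatorI)
  from hecke_ideal_closed(2)[OF this, of "scalar a"] show ?thesis
    by (simp add: cls_eq_iff right_diff_distrib)
qed

lemma cls_scalar_in_hecke_sub: "cls q (scalar a) \<in> hecke_sub q i"
  using hecke_sub_closed(5)[of q "Poly_Mapping.single 0 a" i] by (simp add: cls_scalar_X)

lemma cls_X_in_hecke_sub: "cls q (tX \<nu>) \<in> hecke_sub q i"
  using hecke_sub_closed(5)[of q "mon \<nu>" i] by (simp add: scalar_simps)

text \<open>Closure under negation is subsumed by the scalar \<open>-1\<close>, and \<open>\<complex>[X]\<close> by scalars and monomials. Working with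
  representatives in the free algebra makes the actions below computable.\<close>

lemma hecke_sub_induct [consumes 1, case_names scalar T X add mult]:
  assumes "a \<in> hecke_sub q i"
    and scalar: "\<And>c. P (cls q (scalar c))"
    and T: "P (cls q (tT i))" and X: "\<And>\<nu>. P (cls q (tX \<nu>))"
    and add: "\<And>x y. cls q x \<in> hecke_sub q i \<Longrightarrow> cls q y \<in> hecke_sub q i \<Longrightarrow>
        P (cls q x) \<Longrightarrow> P (cls q y) \<Longrightarrow> P (cls q (x + y))"
    and mult: "\<And>x y. cls q x \<in> hecke_sub q i \<Longrightarrow> cls q y \<in> hecke_sub q i \<Longrightarrow>
        P (cls q x) \<Longrightarrow> P (cls q y) \<Longrightarrow> P (cls q (x * y))"
  shows "P a"
proof -
  have in_sub: "h \<in> hecke_sub q i \<Longrightarrow> \<exists>x. h = cls q x" for h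
    using hecke_sub_carrier[of q i] by (auto simp: carrier_hecke)
  have lift: "P (cls q (lift_group_alg f))" for f
  proof (induction f rule: poly_mapping_induct_single)
    case zero
    then show ?case using scalar[of 0] by (simp add: scalar_simps)
  next
    case (add f g)
    then show ?case
      using assms(5)[of "lift_group_alg f" "lift_group_alg g"]
      by (simp add: lift_group_alg_add hecke_sub_closed)
  next
    case (single \<nu> c)
    then show ?case
      using mult[OF cls_scalar_in_hecke_sub cls_X_in_hecke_sub scalar X] by simp
  qed
  from assms(1) have "a \<in> generate_ring (hecke q)
      (insert (cls q (tT i)) (range (\<lambda>f. cls q (lift_group_alg f))))"
    by (simp add: hecke_sub_def)
  then show ?thesis
  proof (induction a rule: generate_ring.induct)
    case one
    then show ?case using scalar[of 1] by (simp add: scalar_simps cls_simps)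
  next
    case (incl h)
    then show ?case using T lift by auto
  next
    case (a_inv h)
    then have h: "h \<in> hecke_sub q i" by (simp add: hecke_sub_def)
    then obtain x where "h = cls q x" using in_sub by blast
    moreover have "cls q (- x) = cls q (scalar (-1) * x)"
      by (simp add: scalar_simps)
    ultimately show ?case
      using mult[of "scalar (-1)" x] scalar a_inv.IH h cls_scalar_in_hecke_sub
      by (simp add: cls_simps(5)[symmetric])
  next
    case (eng_add h k)
    then have hk: "h \<in> hecke_sub q i" "k \<in> hecke_sub q i" by (simp_all add: hecke_sub_def)
    then obtain x y where "h = cls q x" "k = cls q y" using in_sub by blast
    then show ?case
      using add[of x y] eng_add.IH hk by (simp add: cls_simps(1)[symmetric])
  next
    case (eng_mult h k)
    then have hk: "h \<in> hecke_sub q i" "k \<in> hecke_sub q i" by (simp_all add: hecke_sub_def)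
    then obtain x y where "h = cls q x" "k = cls q y" using in_sub by blast
    then show ?case
      using mult[of x y] eng_mult.IH hk by (simp add: cls_simps(2)[symmetric])
  qed
qed

section \<open>Representations of the affine Hecke algebra\<close>

locale hecke_representation = free_algebra_action scale \<rho>
  for scale :: "complex \<Rightarrow> 'e::ab_group_add \<Rightarrow> 'e" (infixr \<open>*s\<close> 75) and \<rho> +
  fixes q :: complex
  assumes X_zero: "\<rho> (GenX 0) e = e"
    and X_add: "\<rho> (GenX (\<nu> + \<mu>)) e = \<rho> (GenX \<nu>) (\<rho> (GenX \<mu>) e)"
    and quadratic: "\<rho> (GenT i) (\<rho> (GenT i) e) = (q - inverse q) *s \<rho> (GenT i) e + e"
    and braid: "\<rho> (GenT One) (\<rho> (GenT Two) (\<rho> (GenT One) (\<rho> (GenT Two) e)))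
      = \<rho> (GenT Two) (\<rho> (GenT One) (\<rho> (GenT Two) (\<rho> (GenT One) e)))"
    and bernstein: "\<rho> (GenX \<nu>) (\<rho> (GenT i) e) = \<rho> (GenT i) (\<rho> (GenX (reflection i \<nu>)) e)
      + (q - inverse q) *s linext (\<lambda>\<mu>. \<rho> (GenX \<mu>) e) (demazure i \<nu>)"
begin

lemma act_relator: "x \<in> hecke_relators q \<Longrightarrow> act x e = 0"
  unfolding hecke_relators_def
  by (elim UnE CollectE exE conjE singletonE; simp add: X_zero X_add quadratic braid bernstein act_lift_group_alg)

lemma act_hecke_ideal:
  assumes "x \<in> hecke_ideal q"
  shows "act x e = 0"
proof -
  let ?I = "{x. \<forall>e. act x e = 0}"
  have "ideal ?I free_ring"
    by (rule ideal_free_ringI) (simp_all add: act_right_0)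
  moreover have "hecke_relators q \<subseteq> ?I"
    using act_relator by blast
  ultimately show ?thesis
    using hecke_ideal_minimal assms by blast
qed

text \<open>The choice of a representative is harmless by \<open>act_hecke_ideal\<close>.\<close>

definition hact :: "free_alg set \<Rightarrow> 'e \<Rightarrow> 'e" where
  "hact a e = act (SOME x. cls q x = a) e"

lemma hact_cls: "hact (cls q x) e = act x e"
proof -
  have "cls q (SOME y. cls q y = cls q x) = cls q x"
    by (rule someI) simp
  then show ?thesis
    using act_hecke_ideal[of _ e] by (force simp: hact_def cls_eq_iff)
qed

end

text \<open>A vector spanning a line stable under the subalgebra of \<open>T\<^sub>i\<close> and \<open>\<complex>[X]\<close>. It serves two purposes: the
  line shows that the one-dimensional module exists, and the map from the induced module to the
  representation that it defines bounds the induced module from below.\<close>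

locale weight_vector = hecke_representation scale \<rho> q
  for scale :: "complex \<Rightarrow> 'e::ab_group_add \<Rightarrow> 'e" (infixr \<open>*s\<close> 75) and \<rho> q +
  fixes v :: 'e and i :: node and \<tau> :: complex and \<theta> :: "weight \<Rightarrow> complex"
  assumes v_nonzero: "v \<noteq> 0"
    and T_v: "\<rho> (GenT i) v = \<tau> *s v"
    and X_v: "\<rho> (GenX \<nu>) v = \<theta> \<nu> *s v"
begin

lemma hecke_sub_line: "a \<in> hecke_sub q i \<Longrightarrow> \<exists>c. hact a v = c *s v"
proof (induction rule: hecke_sub_induct)
  case (add x y)
  then show ?case by (metis act_left(2) hact_cls scale_left_distrib)
next
  case (mult x y)
  then show ?case by (metis act_mult act_right(2) hact_cls scale_scale)
qed (auto simp: hact_cls T_v X_v)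

definition eigenvalue :: "free_alg set \<Rightarrow> complex" where
  "eigenvalue a = (SOME c. hact a v = c *s v)"

lemma hact_v: "a \<in> hecke_sub q i \<Longrightarrow> hact a v = eigenvalue a *s v"
  unfolding eigenvalue_def using hecke_sub_line by (rule someI_ex)

lemma eigenvalue_eqI:
  assumes "act x v = c *s v"
  shows "eigenvalue (cls q x) = c"
  using assms someI[of "\<lambda>c. hact (cls q x) v = c *s v" c] v_nonzero
  by (simp add: eigenvalue_def hact_cls)

text \<open>Well-definedness of a one-dimensional module cannot be read off the generators, because relations of
  the big algebra might impose further relations on the subalgebra. It is inherited from the
  stable line \<open>\<complex> v\<close>.\<close>

lemma one_dim_module_exists: "\<exists>V. is_one_dim_module q i \<tau> \<theta> V"
proof -
  let ?R = "hecke q\<lparr>carrier := hecke_sub q i\<rparr>"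
  define V :: "(free_alg set, complex) module" where
    "V = \<lparr>carrier = UNIV, monoid.mult = undefined, monoid.one = undefined, ring.zero = 0,
       ring.add = (+), module.smult = (\<lambda>a z. eigenvalue a * z)\<rparr>"
  interpret R: ring ?R by (rule ring_hecke_sub)
  interpret V: abelian_group V
    by (rule abelian_groupI) (auto simp: V_def ac_simps intro: exI[of _ "- x" for x])
  have ev_sub: "\<exists>x. a = cls q x \<and> act x v = eigenvalue a *s v" if a: "a \<in> hecke_sub q i" for a
  proof -
    obtain x where "a = cls q x"
      using a hecke_sub_carrier[of q i] by (auto simp: carrier_hecke)
    with hact_v[OF a] show ?thesis by (auto simp: hact_cls)
  qed
  have "left_module ?R V"
  proof
    fix a b and z w :: complex
    assume a: "a \<in> carrier ?R" and b: "b \<in> carrier ?R"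
    obtain x y where x: "a = cls q x" "act x v = eigenvalue a *s v"
      and y: "b = cls q y" "act y v = eigenvalue b *s v"
      using ev_sub[of a] ev_sub[of b] a b by auto
    have "eigenvalue (a \<oplus>\<^bsub>hecke q\<^esub> b) = eigenvalue a + eigenvalue b"
      unfolding x(1) y(1) cls_simps(1)[symmetric]
      by (rule eigenvalue_eqI) (use x y in \<open>simp add: scale_left_distrib\<close>)
    then show "(a \<oplus>\<^bsub>?R\<^esub> b) \<odot>\<^bsub>V\<^esub> z = a \<odot>\<^bsub>V\<^esub> z \<oplus>\<^bsub>V\<^esub> b \<odot>\<^bsub>V\<^esub> z"
      by (simp add: V_def distrib_right)
    have "eigenvalue (a \<otimes>\<^bsub>hecke q\<^esub> b) = eigenvalue a * eigenvalue b"
      unfolding x(1) y(1) cls_simps(2)[symmetric]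
      by (rule eigenvalue_eqI) (use x y in \<open>simp add: act_right mult.commute\<close>)
    then show "(a \<otimes>\<^bsub>?R\<^esub> b) \<odot>\<^bsub>V\<^esub> z = a \<odot>\<^bsub>V\<^esub> (b \<odot>\<^bsub>V\<^esub> z)"
      by (simp add: V_def)
  next
    fix z :: complex
    have "eigenvalue \<one>\<^bsub>hecke q\<^esub> = 1"
      unfolding cls_simps(3)[symmetric] by (rule eigenvalue_eqI) simp
    then show "\<one>\<^bsub>?R\<^esub> \<odot>\<^bsub>V\<^esub> z = z"
      by (simp add: V_def)
  qed (simp_all add: V_def distrib_left)
  moreover have "eigenvalue (cls q (scalar c)) = c" "eigenvalue (cls q (tT i)) = \<tau>"
    "eigenvalue (cls q (tX \<nu>)) = \<theta> \<nu>" for c \<nu>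
    by (rule eigenvalue_eqI; simp add: T_v X_v)+
  ultimately have "is_one_dim_module q i \<tau> \<theta> V"
    by (simp add: is_one_dim_module_def V_def)
  then show ?thesis by blast
qed

definition V :: "(free_alg set, complex) module" where
  "V = one_dim_module q i \<tau> \<theta>"

lemma V: "is_one_dim_module q i \<tau> \<theta> V"
  unfolding V_def one_dim_module_def by (rule someI_ex[OF one_dim_module_exists])

lemma V_simps [simp]:
  "carrier V = UNIV" "z \<oplus>\<^bsub>V\<^esub> w = z + w" "cls q (scalar c) \<odot>\<^bsub>V\<^esub> z = c * z"
  "cls q (tT i) \<odot>\<^bsub>V\<^esub> z = \<tau> * z" "cls q (tX \<nu>) \<odot>\<^bsub>V\<^esub> z = \<theta> \<nu> * z"
  using V by (simp_all add: is_one_dim_module_def del: split_paired_All)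

lemma left_module_V: "left_module (hecke q\<lparr>carrier := hecke_sub q i\<rparr>) V"
  using V by (simp add: is_one_dim_module_def)

lemma hact_line:
  assumes "a \<in> hecke_sub q i"
  shows "hact a (z *s v) = (a \<odot>\<^bsub>V\<^esub> z) *s v"
proof -
  interpret V: left_module "hecke q\<lparr>carrier := hecke_sub q i\<rparr>" V
    by (rule left_module_V)
  show ?thesis
    using assms
  proof (induction arbitrary: z rule: hecke_sub_induct)
    case (add x y)
    then show ?case
      using V.smult_l_distr[of "cls q x" "cls q y" z]
      by (simp add: hact_cls scale_left_distrib flip: cls_simps(1))
  next
    case (mult x y)
    then show ?case
      using V.smult_assoc[of "cls q x" "cls q y" z]
      by (simp add: hact_cls flip: cls_simps(2))
  qed (simp_all add: hact_cls act_right T_v X_v mult.commute)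
qed

sublocale T: tensor_data "hecke q" "hecke_sub q i" V
  using ring_hecke hecke_sub_carrier by (simp add: tensor_data_def tensor_data_axioms_def)

text \<open>This is the universal property of the induced module: \<open>r \<otimes> z \<mapsto> r (z v)\<close> respects the tensor relators, hence
  vanishes on the subgroup \<open>T.K\<close> that they generate.\<close>

lemma tensor_eq_0_imp:
  assumes "T.tensor (cls q x) 1 = \<zero>\<^bsub>T.M\<^esub>"
  shows "act x v = 0"
proof -
  define \<phi> :: "(free_alg set \<times> complex \<Rightarrow>\<^sub>0 int) \<Rightarrow> 'e" where
    "\<phi> f = (\<Sum>k\<in>Poly_Mapping.keys f. of_int (Poly_Mapping.lookup f k) *s hact (fst k) (snd k *s v))"
    for f
  have \<phi>_add: "\<phi> (f + g) = \<phi> f + \<phi> g" for f g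
    unfolding \<phi>_def by (rule setsum_keys_plus_distrib) (simp_all add: scale_left_distrib)
  have \<phi>_0: "\<phi> 0 = 0" by (simp add: \<phi>_def)
  have \<phi>_minus: "\<phi> (- f) = - \<phi> f" for f
    using \<phi>_add[of f "- f"] \<phi>_0 by (simp add: eq_neg_iff_add_eq_0 add.commute)
  have \<phi>_diff: "\<phi> (f - g) = \<phi> f - \<phi> g" for f g
    using \<phi>_add[of f "- g"] by (simp add: \<phi>_minus)
  have \<phi>_frag: "\<phi> (frag_of (r, z)) = hact r (z *s v)" for r z
    by (simp add: \<phi>_def)
  have "\<phi> f = 0" if "f \<in> T.K" for f
    using that
  proof (induction f rule: T.K_induct)
    case (relator f)
    then show ?case
    proof (cases rule: T.relator_cases)
      case (add_left r r' z)
      then obtain x y where "r = cls q x" "r' = cls q y" by (auto simp: carrier_hecke)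
      then show ?thesis
        by (simp add: add_left(4) \<phi>_diff \<phi>_add \<phi>_frag hact_cls flip: cls_simps)
    next
      case (add_right r z w)
      then obtain x where "r = cls q x" by (auto simp: carrier_hecke)
      then show ?thesis
        by (simp add: add_right(4) \<phi>_diff \<phi>_add \<phi>_frag hact_cls act_right scale_left_distrib)
    next
      case (balanced r a z)
      then obtain x y where xy: "r = cls q x" "a = cls q y"
        using hecke_sub_carrier[of q i] by (auto simp: carrier_hecke)
      have "act y (z *s v) = (a \<odot>\<^bsub>V\<^esub> z) *s v"
        using hact_line[of a z] balanced by (simp add: xy hact_cls)
      with xy show ?thesis
        by (simp add: balanced(4) \<phi>_diff \<phi>_frag hact_cls flip: cls_simps)
    qed
  qed (simp_all add: \<phi>_0 \<phi>_minus \<phi>_add)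
  moreover have "frag_of (cls q x, 1) \<in> T.K"
    using assms by (simp add: T.tensor_def T.zero_M T.coset_eq_iff)
  ultimately show ?thesis
    using \<phi>_frag[of "cls q x" 1] by (simp add: hact_cls)
qed

end

text \<open>The left ideals of the free algebra containing the annihilator of the generator \<open>1 \<otimes> 1\<close> of the
  induced module. Computing modulo such an ideal replaces computing in the quotient of quotients
  that carries the induced module.\<close>

definition inducing_left_ideal ::
    "complex \<Rightarrow> node \<Rightarrow> complex \<Rightarrow> (weight \<Rightarrow> complex) \<Rightarrow> free_alg set \<Rightarrow> bool" where
  "inducing_left_ideal q i \<tau> \<theta> J \<longleftrightarrow>
     hecke_ideal q \<subseteq> J \<and> (\<forall>x\<in>J. \<forall>y\<in>J. x + y \<in> J) \<and> (\<forall>x. \<forall>y\<in>J. x * y \<in> J) \<and>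
     tT i - scalar \<tau> \<in> J \<and> (\<forall>\<nu>. tX \<nu> - scalar (\<theta> \<nu>) \<in> J)"

context weight_vector
begin

text \<open>By the second hypothesis the map from the induced module to the representation is injective, and by
  the first one every nonzero vector of the representation generates \<open>v\<close>. So every nonzero element of
  the induced module generates a preimage of \<open>v\<close>, which can only be the generator \<open>1 \<otimes> 1\<close>.\<close>

theorem irreducible_induced:
  assumes transitive: "\<And>e. e \<noteq> 0 \<Longrightarrow> \<exists>h. act h e = v"
    and annihilator: "\<And>J x. inducing_left_ideal q i \<tau> \<theta> J \<Longrightarrow> act x v = 0 \<Longrightarrow> x \<in> J"
  shows "irreducible_module (hecke q) (induced_module (hecke q) (hecke_sub q i) V)"
proof -
  interpret M: left_module "hecke q" T.M by (rule T.left_module_M)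
  define w where "w = T.tensor \<one>\<^bsub>hecke q\<^esub> 1"
  have w: "w \<in> carrier T.M"
    unfolding w_def by (rule T.tensor_closed) simp_all
  have smult_w: "cls q x \<odot>\<^bsub>T.M\<^esub> w = T.tensor (cls q x) 1" for x
    by (simp add: w_def T.smult_tensor)
  have tensor_sub: "T.tensor (r \<otimes>\<^bsub>hecke q\<^esub> a) 1 = T.tensor r (a \<odot>\<^bsub>V\<^esub> 1)"
    if "r \<in> carrier (hecke q)" "a \<in> hecke_sub q i" for r a
    using T.tensor_balanced[OF that, of 1] by simp
  have tensor_scalar: "T.tensor (r \<otimes>\<^bsub>hecke q\<^esub> cls q (scalar z)) 1 = T.tensor r z"
    if "r \<in> carrier (hecke q)" for r z
    using tensor_sub[OF that cls_scalar_in_hecke_sub] by simp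
  define J where "J = {x. cls q x \<odot>\<^bsub>T.M\<^esub> w = \<zero>\<^bsub>T.M\<^esub>}"
  have J_diff: "x - y \<in> J \<longleftrightarrow> cls q x \<odot>\<^bsub>T.M\<^esub> w = cls q y \<odot>\<^bsub>T.M\<^esub> w" for x y
  proof -
    have "cls q (x - y) = cls q x \<ominus>\<^bsub>hecke q\<^esub> cls q y"
      using cls_simps(1)[of q x "- y"] by (simp add: cls_simps(5) a_minus_def)
    then show ?thesis
      using M.smult_diff_eq_zero_iff[of "cls q x" "cls q y" w] w by (simp add: J_def)
  qed
  have J: "inducing_left_ideal q i \<tau> \<theta> J"
    unfolding inducing_left_ideal_def
  proof (intro conjI ballI allI subsetI)
    fix x assume "x \<in> hecke_ideal q"
    then have "cls q x = \<zero>\<^bsub>hecke q\<^esub>"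
      by (simp add: cls_eq_iff flip: cls_simps(4))
    then show "x \<in> J"
      using w by (simp add: J_def M.zero_smult)
  next
    fix x y assume "x \<in> J" "y \<in> J"
    then show "x + y \<in> J"
      using w by (simp add: J_def cls_simps M.smult_l_distr)
  next
    fix x y assume "y \<in> J"
    then show "x * y \<in> J"
      using w by (simp add: J_def cls_simps M.smult_assoc M.smult_zero)
  next
    show "tT i - scalar \<tau> \<in> J"
      using tensor_sub[of "\<one>\<^bsub>hecke q\<^esub>" "cls q (tT i)"] tensor_scalar[of "\<one>\<^bsub>hecke q\<^esub>" \<tau>]
      by (simp add: J_diff smult_w hecke_sub_closed)
  next
    fix \<nu>
    show "tX \<nu> - scalar (\<theta> \<nu>) \<in> J"
      using tensor_sub[of "\<one>\<^bsub>hecke q\<^esub>" "cls q (tX \<nu>)"] tensor_scalar[of "\<one>\<^bsub>hecke q\<^esub>" "\<theta> \<nu>"]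
      by (simp add: J_diff smult_w cls_X_in_hecke_sub)
  qed
  have cyclic: "\<exists>x. m = cls q x \<odot>\<^bsub>T.M\<^esub> w" if "m \<in> carrier T.M" for m
  proof -
    have "\<exists>a\<in>carrier (hecke q). m = T.tensor a 1"
    proof (rule T.M_eq_multiples)
      fix r z assume r: "r \<in> carrier (hecke q)"
      show "\<exists>a\<in>carrier (hecke q). T.tensor r z = T.tensor a 1"
        by (rule bexI[of _ "r \<otimes>\<^bsub>hecke q\<^esub> cls q (scalar z)"]) (simp_all add: tensor_scalar r)
    qed (use that in simp_all)
    then show ?thesis by (auto simp: carrier_hecke smult_w)
  qed
  have "w \<noteq> \<zero>\<^bsub>T.M\<^esub>"
    using tensor_eq_0_imp[of 1] v_nonzero by (auto simp: w_def cls_simps)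
  moreover have "N = {\<zero>\<^bsub>T.M\<^esub>} \<or> N = carrier T.M" if "submodule N (hecke q) T.M" for N
  proof (rule disjCI)
    interpret N: submodule N "hecke q" T.M by fact
    assume "N \<noteq> carrier T.M"
    have "w \<notin> N"
      using \<open>N \<noteq> carrier T.M\<close> N.subset cyclic N.smult_closed
      by (metis cls_closed partial_object.simps(1) monoid.simps(1) subsetI subset_antisym)
    show "N = {\<zero>\<^bsub>T.M\<^esub>}"
    proof (rule ccontr)
      assume "N \<noteq> {\<zero>\<^bsub>T.M\<^esub>}"
      then obtain n where n: "n \<in> N" "n \<noteq> \<zero>\<^bsub>T.M\<^esub>"
        using N.one_closed by auto
      then obtain x where x: "n = cls q x \<odot>\<^bsub>T.M\<^esub> w"
        using cyclic N.subset by auto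
      have "act x v \<noteq> 0"
        using annihilator[OF J, of x] n(2) by (auto simp: x J_def)
      then obtain h where "act h (act x v) = v"
        using transitive by blast
      then have "h * x - 1 \<in> J"
        by (intro annihilator[OF J]) simp
      then have "w = cls q h \<odot>\<^bsub>T.M\<^esub> n"
        using w by (simp add: J_diff x cls_simps M.smult_assoc M.smult_one)
      then show False
        using N.smult_closed[of "cls q h" n] n(1) \<open>w \<notin> N\<close> by simp
    qed
  qed
  ultimately show ?thesis
    using T.left_module_M w by (auto simp: irreducible_module_def T.M_def[symmetric])
qed

end

section \<open>The induced module has dimension at most four\<close>

text \<open>The four words are the minimal representatives of the cosets of \<open>\<langle>s\<^sub>2\<rangle>\<close> in the Weyl group. Their span modulo
  \<open>J\<close> contains \<open>1\<close> and is stable under the generators: under \<open>T\<^sub>1\<close> and \<open>T\<^sub>2\<close> by the quadratic and braid relations, where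
  a trailing \<open>T\<^sub>2\<close> becomes the scalar \<open>\<tau>\<close>, and under \<open>X\<^sup>\<nu>\<close> because the Bernstein relation moves it to the
  right end of a word at the cost of shorter words.\<close>

lemma inducing_left_ideal_span:
  assumes J: "inducing_left_ideal q Two \<tau> \<theta> J"
  shows "\<exists>c0 c1 c2 c3. x - (scalar c0 + scalar c1 * tT One + scalar c2 * (tT Two * tT One)
      + scalar c3 * (tT One * (tT Two * tT One))) \<in> J"
proof -
  let ?T1 = "tT One" and ?T2 = "tT Two"
  define p where "p = q - inverse q"
  define comb where "comb c0 c1 c2 c3 = scalar c0 + scalar c1 * ?T1 + scalar c2 * (?T2 * ?T1)
      + scalar c3 * (?T1 * (?T2 * ?T1))" for c0 c1 c2 c3
  define S where "S = {x. \<exists>c0 c1 c2 c3. x - comb c0 c1 c2 c3 \<in> J}"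
  have J_add: "x + y \<in> J" if "x \<in> J" "y \<in> J" for x y
    using J that by (simp add: inducing_left_ideal_def)
  have J_mult: "y * x \<in> J" if "x \<in> J" for x y
    using J that by (simp add: inducing_left_ideal_def)
  have J_0: "0 \<in> J"
    using J J_mult[of _ 0] by (auto simp: inducing_left_ideal_def)
  have comb_add: "comb c0 c1 c2 c3 + comb d0 d1 d2 d3
      = comb (c0 + d0) (c1 + d1) (c2 + d2) (c3 + d3)" for c0 c1 c2 c3 d0 d1 d2 d3
    by (simp add: comb_def scalar_simps algebra_simps)
  have comb_scale: "scalar a * comb c0 c1 c2 c3 = comb (a * c0) (a * c1) (a * c2) (a * c3)"
    for a c0 c1 c2 c3
    by (simp add: comb_def scalar_simps algebra_simps)
  have S_add: "x + y \<in> S" if xy: "x \<in> S" "y \<in> S" for x y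
  proof -
    obtain c0 c1 c2 c3 d0 d1 d2 d3
      where "x - comb c0 c1 c2 c3 \<in> J" "y - comb d0 d1 d2 d3 \<in> J"
      using xy by (auto simp: S_def)
    from J_add[OF this] have "(x + y) - comb (c0 + d0) (c1 + d1) (c2 + d2) (c3 + d3) \<in> J"
      by (simp add: algebra_simps flip: comb_add)
    then show ?thesis by (auto simp: S_def)
  qed
  have S_scale: "scalar a * x \<in> S" if x: "x \<in> S" for a x
  proof -
    obtain c0 c1 c2 c3 where "x - comb c0 c1 c2 c3 \<in> J"
      using x by (auto simp: S_def)
    from J_mult[OF this, of "scalar a"]
    have "scalar a * x - comb (a * c0) (a * c1) (a * c2) (a * c3) \<in> J"
      by (simp add: right_diff_distrib comb_scale)
    then show ?thesis by (auto simp: S_def)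
  qed
  have J_S: "x \<in> S" if "x \<in> J" for x
  proof -
    have "x - comb 0 0 0 0 \<in> J"
      using that by (simp add: comb_def scalar_simps)
    then show ?thesis by (auto simp: S_def)
  qed
  have S_cong: "x \<in> S" if "x - y \<in> J" "y \<in> S" for x y
    using S_add[OF J_S[OF that(1)] that(2)] by simp
  have S_basis: "1 \<in> S" "?T1 \<in> S" "?T2 * ?T1 \<in> S" "?T1 * (?T2 * ?T1) \<in> S"
  proof -
    have "1 - comb 1 0 0 0 \<in> J" "?T1 - comb 0 1 0 0 \<in> J" "?T2 * ?T1 - comb 0 0 1 0 \<in> J"
      "?T1 * (?T2 * ?T1) - comb 0 0 0 1 \<in> J"
      by (simp_all add: comb_def scalar_simps J_0)
    then show "1 \<in> S" "?T1 \<in> S" "?T2 * ?T1 \<in> S" "?T1 * (?T2 * ?T1) \<in> S"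
      unfolding S_def by blast+
  qed
  have S_left: "g * x \<in> S" if g: "g \<in> S" "g * ?T1 \<in> S" "g * (?T2 * ?T1) \<in> S"
    "g * (?T1 * (?T2 * ?T1)) \<in> S" and x: "x \<in> S" for g x
  proof -
    obtain c0 c1 c2 c3 where "x - comb c0 c1 c2 c3 \<in> J"
      using x by (auto simp: S_def)
    from J_mult[OF this, of g] have "g * x - g * comb c0 c1 c2 c3 \<in> J"
      by (simp add: right_diff_distrib)
    moreover have "g * comb c0 c1 c2 c3 = scalar c0 * g + scalar c1 * (g * ?T1)
        + scalar c2 * (g * (?T2 * ?T1)) + scalar c3 * (g * (?T1 * (?T2 * ?T1)))"
      by (simp add: comb_def distrib_left scalar_commute[of g] flip: mult.assoc)
    ultimately show ?thesis
      using S_cong g by (simp add: S_add S_scale)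
  qed
  have relator: "l * y - r * y \<in> J" if "l - r \<in> hecke_relators q" for l r y
  proof -
    have "(l - r) * y \<in> hecke_ideal q"
      using that by (intro hecke_ideal_closed hecke_relators_in_ideal)
    then show ?thesis
      using J by (auto simp: left_diff_distrib inducing_left_ideal_def)
  qed
  have quadratic: "tT i * (tT i * y) \<in> S" if "y \<in> S" "tT i * y \<in> S" for i y
  proof (rule S_cong)
    show "tT i * (tT i * y) - (scalar p * (tT i * y) + y) \<in> J"
      using relator[OF hecke_relatorI(3), of i y] by (simp add: p_def mult.assoc distrib_right)
    show "scalar p * (tT i * y) + y \<in> S"
      using that by (intro S_add S_scale)
  qed
  have T1: "?T1 * x \<in> S" if "x \<in> S" for x
    using S_left[of ?T1, OF _ _ _ _ that] S_basis quadratic[of 1 One]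
      quadratic[of "?T2 * ?T1" One] by simp
  have "?T2 \<in> S"
    by (rule S_cong[of _ "scalar \<tau> * 1"])
       (use J S_scale[OF S_basis(1)] in \<open>simp_all add: inducing_left_ideal_def\<close>)
  moreover have "?T2 * (?T1 * (?T2 * ?T1)) \<in> S"
  proof (rule S_cong)
    from relator[OF hecke_relatorI(4), of 1] have "?T1 * (?T2 * (?T1 * ?T2)) - ?T2 * (?T1 * (?T2 * ?T1)) \<in> J"
      by (simp add: mult.assoc)
    from J_mult[OF this, of "-1"]
    have 1: "?T2 * (?T1 * (?T2 * ?T1)) - ?T1 * (?T2 * (?T1 * ?T2)) \<in> J" by simp
    have "?T1 * (?T2 * ?T1) * (?T2 - scalar \<tau>) \<in> J"
      using J by (intro J_mult) (simp add: inducing_left_ideal_def)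
    then have "?T1 * (?T2 * (?T1 * ?T2)) - scalar \<tau> * (?T1 * (?T2 * ?T1)) \<in> J"
      by (simp add: right_diff_distrib scalar_commute mult.assoc)
    from J_add[OF 1 this]
    show "?T2 * (?T1 * (?T2 * ?T1)) - scalar \<tau> * (?T1 * (?T2 * ?T1)) \<in> J" by simp
    show "scalar \<tau> * (?T1 * (?T2 * ?T1)) \<in> S"
      by (intro S_scale S_basis)
  qed
  ultimately have T2: "?T2 * x \<in> S" if "x \<in> S" for x
    using S_left[of ?T2, OF _ _ _ _ that] S_basis quadratic[of ?T1 Two] by simp
  have T: "tT i * x \<in> S" if "x \<in> S" for i x
    using that T1 T2 by (cases i) auto
  \<comment> \<open>Quantifying over all \<open>\<nu>\<close> at once matters: passing \<open>T\<^sub>i\<close> changes the exponent.\<close>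
  have X_step: "tX \<nu> * (tT i * y) \<in> S" if y: "\<And>\<nu>. tX \<nu> * y \<in> S" for i y \<nu>
  proof (rule S_cong)
    let ?D = "lift_group_alg (demazure i \<nu>)"
    show "tX \<nu> * (tT i * y) - (tT i * (tX (reflection i \<nu>) * y) + scalar p * (?D * y)) \<in> J"
      using relator[OF hecke_relatorI(5), of \<nu> i y] by (simp add: p_def mult.assoc distrib_right)
    have "lift_group_alg f * y \<in> S" for f
      by (induction f rule: poly_mapping_induct_single)
         (simp_all add: J_S J_0 lift_group_alg_add distrib_right S_add mult.assoc S_scale y)
    then show "tT i * (tX (reflection i \<nu>) * y) + scalar p * (?D * y) \<in> S"
      by (intro S_add S_scale T y)
  qed
  have X0: "tX \<nu> * 1 \<in> S" for \<nu>
    by (rule S_cong[of _ "scalar (\<theta> \<nu>) * 1"])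
       (use J S_scale[OF S_basis(1)] in \<open>simp_all add: inducing_left_ideal_def del: split_paired_All\<close>)
  have X: "tX \<nu> * x \<in> S" if "x \<in> S" for \<nu> x
  proof (rule S_left[OF _ _ _ _ that])
    note X1 = X_step[OF X0, of _ One]
    note X2 = X_step[OF X1, of _ Two]
    note X3 = X_step[OF X2, of _ One]
    show "tX \<nu> \<in> S" "tX \<nu> * ?T1 \<in> S" "tX \<nu> * (?T2 * ?T1) \<in> S" "tX \<nu> * (?T1 * (?T2 * ?T1)) \<in> S"
      using X0[of \<nu>] X1[of \<nu>] X2[of \<nu>] X3[of \<nu>] by simp_all
  qed
  have gen: "gen g * x \<in> S" if "x \<in> S" for g x
    using that T X by (cases g) auto
  have word: "Poly_Mapping.single (Word l) 1 \<in> S" for l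
  proof (induction l)
    case Nil
    then show ?case using S_basis(1) by (simp flip: zero_word_def)
  next
    case (Cons g l)
    have "Poly_Mapping.single (Word (g # l)) 1 = gen g * Poly_Mapping.single (Word l) 1"
      by (simp add: gen_def mult_single plus_word_def)
    then show ?case using gen[OF Cons] by simp
  qed
  have "x \<in> S"
  proof (induction x rule: poly_mapping_induct_single)
    case zero
    then show ?case by (rule J_S[OF J_0])
  next
    case (add f g)
    then show ?case by (rule S_add)
  next
    case (single w c)
    have "Poly_Mapping.single w c = scalar c * Poly_Mapping.single (Word (letters w)) 1"
      by (simp add: scalar_def mult_single)
    then show ?case using S_scale[OF word, of c "letters w"] by (simp only:)
  qed
  then show ?thesis by (simp add: S_def comb_def)
qed

section \<open>A four-dimensional representation with two weights\<close>

text \<open>The representation is the sum of the generalised weight spaces of \<open>t\<close> and \<open>s\<^sub>1 t\<close>, both of dimension two.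
  The lattice acts on each by dual numbers \<open>u + v N\<close> with \<open>N\<^sup>2 = 0\<close>.\<close>

type_synonym block = "complex \<times> complex"

text \<open>Multiplication by \<open>u + v N\<close>, where \<open>N\<close> sends the second basis vector to the first one.\<close>

definition dual :: "complex \<Rightarrow> complex \<Rightarrow> block \<Rightarrow> block" where
  "dual u v = (\<lambda>(a, b). (u * a + v * b, u * b))"

lemma dual_simp [simp]: "dual u v (a, b) = (u * a + v * b, u * b)"
  by (simp add: dual_def)

lemma dual_add: "dual u v (x + y) = dual u v x + dual u v y"
  by (cases x; cases y) (simp add: algebra_simps)

lemma dual_commute: "dual u v (dual u' v' x) = dual u' v' (dual u v x)"
  by (cases x) (simp add: algebra_simps)

definition cscale :: "complex \<Rightarrow> block \<times> block \<Rightarrow> block \<times> block" where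
  "cscale c = map_prod (dual c 0) (dual c 0)"

lemma cscale_simp [simp]: "cscale c (x, y) = (dual c 0 x, dual c 0 y)"
  by (simp add: cscale_def)

lemma complex_space_cscale: "complex_space cscale"
  by standard (auto simp: algebra_simps)

lemma reflection_simps:
  "reflection One \<nu> = (- fst \<nu>, fst \<nu> + snd \<nu>)"
  "reflection Two \<nu> = (fst \<nu> + 2 * snd \<nu>, - snd \<nu>)"
  by (simp_all add: reflection_def zmul_def prod_eq_iff)

lemma reflection_involution: "reflection i (reflection i \<nu>) = \<nu>"
  by (cases i) (simp_all add: reflection_simps)

lemma reflection_add: "reflection i (\<nu> + \<mu>) = reflection i \<nu> + reflection i \<mu>"
  by (cases i) (simp_all add: reflection_simps)

text \<open>As \<open>q\<^sup>2 \<noteq> 1\<close>, the excluded roots of unity are exactly the solutions of \<open>q\<^sup>3 = \<epsilon>\<close>.\<close>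

locale special_weight =
  fixes q \<epsilon> :: complex and t :: "weight \<Rightarrow> complex"
  assumes q0: "q \<noteq> 0" and q2: "q\<^sup>2 \<noteq> 1" and eps: "\<epsilon> \<in> {1, -1}"
    and char: "is_character t" and t_root1: "t (simple_root One) = \<epsilon> * q"
    and t_root2: "t (simple_root Two) = 1" and q3: "q ^ 3 \<noteq> \<epsilon>"
begin

text \<open>Here \<open>z\<close> is the value of \<open>t\<close> at \<open>\<alpha>\<^sub>1\<close>. The dual number \<open>g0 + g1 N\<close> is \<open>p / (1 - X\<^bsup>-\<alpha>\<^sub>1\<^esup>)\<close> on the block of weight \<open>t\<close>, where
  \<open>X\<^bsup>\<alpha>\<^sub>1\<^esup> = z (1 - N)\<close>, and \<open>h0 - g1 N\<close> is the same operator on the block of weight \<open>s\<^sub>1 t\<close>, where \<open>X\<^bsup>\<alpha>\<^sub>1\<^esup>\<close> is the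
  inverse \<open>z\<^bsup>-1\<^esup> (1 + N)\<close>. Their values simplify because \<open>z\<^sup>2 = q\<^sup>2\<close>.\<close>

definition "p = q - inverse q"
definition "z = \<epsilon> * q"
definition "g0 = q + \<epsilon>"
definition "g1 = (\<epsilon> * q + 1) / (q - \<epsilon>)"
definition "h0 = p - g0"

text \<open>On the block of weight \<open>t\<close>, the Bernstein relation for \<open>\<alpha>\<^sub>2\<close> forces \<open>N U + U N = p (1 + N)\<close>; together with
  the quadratic relation this determines \<open>U\<close> up to a change of basis. The operator \<open>K\<close> is the square of
  the intertwiner \<open>T\<^sub>1 - p / (1 - X\<^bsup>-\<alpha>\<^sub>1\<^esup>)\<close> that exchanges the two blocks.\<close>

definition "G = dual g0 g1"
definition "H = dual h0 (- g1)"
definition "K x = x + G (H x)"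
definition "U = (\<lambda>(a, b). (b / p, p * a + p * b))"

text \<open>The first component has weight \<open>t\<close> and the second one weight \<open>s\<^sub>1 t\<close>. On the second block \<open>T\<^sub>2\<close> can
  only be \<open>p / (1 - X\<^bsup>-\<alpha>\<^sub>2\<^esup>)\<close>, because \<open>s\<^sub>2 s\<^sub>1 t\<close> is not a weight of the representation and the intertwiner for \<open>\<alpha>\<^sub>2\<close>
  has to vanish there; this is the scalar \<open>q\<close>, since \<open>X\<^bsup>\<alpha>\<^sub>2\<^esup>\<close> acts on this block by the scalar \<open>q\<^sup>2\<close>. The basis of the second block is the image of the first one under the intertwiner for \<open>\<alpha>\<^sub>1\<close>.\<close>

fun \<rho> :: "gen \<Rightarrow> block \<times> block \<Rightarrow> block \<times> block" where
  "\<rho> (GenX \<nu>) (x, y) =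
     (dual (t \<nu>) (t \<nu> * of_int (snd \<nu>)) x,
      dual (t (reflection One \<nu>)) (t (reflection One \<nu>) * of_int (fst \<nu> + snd \<nu>)) y)"
| "\<rho> (GenT Two) (x, y) = (U x, dual q 0 y)"
| "\<rho> (GenT One) (x, y) = (G x + K y, x + H y)"

lemma U_simp [simp]: "U (a, b) = (b / p, p * a + p * b)"
  by (simp add: U_def)

lemmas block_defs = G_def H_def K_def

lemma q_sq: "q * q \<noteq> 1" "q \<noteq> 1" "q \<noteq> - 1" "q \<noteq> \<epsilon>" "\<epsilon> * \<epsilon> = 1"
  using q2 eps by (auto simp: power2_eq_square)

lemma p_nonzero: "p \<noteq> 0"
  using q0 q_sq by (auto simp: p_def field_simps)

lemma K_simp: "K (a, b) = ((1 + g0 * h0) * a + g1 * (h0 - g0) * b, (1 + g0 * h0) * b)"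
  by (simp add: block_defs algebra_simps)

text \<open>This is where the excluded roots of unity enter: the intertwiner between the two blocks is
  invertible in both directions.\<close>

lemma k0_nonzero: "1 + g0 * h0 \<noteq> 0"
proof
  assume "1 + g0 * h0 = 0"
  moreover have "1 + g0 * h0 = - (\<epsilon> / q) * (q\<^sup>2 + \<epsilon> * q + 1)"
    using q0 eps by (auto simp: h0_def g0_def p_def field_simps power2_eq_square)
  ultimately have "q\<^sup>2 + \<epsilon> * q + 1 = 0"
    using q0 eps by auto
  moreover have "q ^ 3 - \<epsilon> = (q - \<epsilon>) * (q\<^sup>2 + \<epsilon> * q + 1)"
    using eps by (auto simp: power2_eq_square power3_eq_cube algebra_simps)
  ultimately show False
    using q3 by simp
qed

lemma constants:
  "g0 - inverse z * g0 = p" "g1 - inverse z * g1 = inverse z * g0"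
  "h0 - z * h0 = p" "g1 - z * g1 = z * h0" "z * z = q * q"
  using q0 q_sq eps
  by (auto simp: z_def g0_def g1_def h0_def p_def divide_simps) (auto simp: algebra_simps)

lemma t_simps: "t 0 = 1" "t (\<nu> + \<mu>) = t \<nu> * t \<mu>" "t \<nu> \<noteq> 0" "t (- \<nu>) = inverse (t \<nu>)"
  "t (\<nu> - \<mu>) = t \<nu> / t \<mu>"
proof -
  show add: "t (\<nu> + \<mu>) = t \<nu> * t \<mu>" and nz: "t \<nu> \<noteq> 0" for \<nu> \<mu>
    using char by (simp_all add: is_character_def del: split_paired_All)
  show "t 0 = 1"
    using add[of 0 0] nz[of 0] by simp
  then show inv: "t (- \<nu>) = inverse (t \<nu>)" for \<nu>
    using add[of \<nu> "- \<nu>"] nz by (simp add: inverse_unique)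
  show "t (\<nu> - \<mu>) = t \<nu> / t \<mu>"
    using add[of \<nu> "- \<mu>"] inv[of \<mu>] by (simp add: divide_inverse)
qed

lemma t_root2_int: "t (zmul k (simple_root Two)) = 1"
proof -
  have nat: "t (zmul (int n) (simple_root Two)) = 1" for n
  proof (induction n)
    case 0
    then show ?case using t_simps(1) by (simp add: zmul_def zero_prod_def)
  next
    case (Suc n)
    have "zmul (int (Suc n)) (simple_root Two) = zmul (int n) (simple_root Two) + simple_root Two"
      by (simp add: zmul_def)
    then show ?case using Suc t_root2 by (simp only: t_simps) simp
  qed
  have "zmul k (simple_root Two) = - zmul (- k) (simple_root Two)"
    by (simp add: zmul_def)
  then show ?thesis
    using nat[of "nat k"] nat[of "nat (- k)"] t_simps(4) by (cases "k \<ge> 0") auto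
qed

lemma t_reflection2: "t (reflection Two \<nu>) = t \<nu>"
  by (simp add: reflection_def t_simps t_root2_int del: simple_root.simps)

lemma t_refl_shift:
  "t (\<nu> - simple_root One) = t \<nu> * inverse z"
  "t (reflection One (\<nu> - simple_root One)) = t (reflection One \<nu>) * z"
  "t (\<nu> - simple_root Two) = t \<nu>"
  "t (reflection One (\<nu> - simple_root Two)) = t (reflection One \<nu>) * inverse (q * q)"
proof -
  show "t (\<nu> - simple_root One) = t \<nu> * inverse z" "t (\<nu> - simple_root Two) = t \<nu>"
    by (simp_all only: t_simps t_root1 t_root2 z_def divide_inverse) simp_all
  have "reflection One (\<nu> - simple_root One) = reflection One \<nu> + simple_root One"
    by (simp add: reflection_simps)
  then show "t (reflection One (\<nu> - simple_root One)) = t (reflection One \<nu>) * z"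
    by (simp only: t_simps t_root1 z_def)
  have "reflection One (\<nu> - simple_root Two)
      = reflection One \<nu> - (simple_root One + simple_root One + simple_root Two)"
    by (simp add: reflection_simps)
  then show "t (reflection One (\<nu> - simple_root Two)) = t (reflection One \<nu>) * inverse (q * q)"
    using constants(5) by (simp only: t_simps t_root1 t_root2 divide_inverse z_def) simp
qed

lemma gen_cases:
  fixes g :: gen
  obtains \<nu> where "g = GenX \<nu>" | "g = GenT One" | "g = GenT Two"
  by (metis gen.exhaust node.exhaust)

sublocale free_algebra_action cscale \<rho>
proof -
  interpret complex_space cscale by (rule complex_space_cscale)
  show "free_algebra_action cscale \<rho>"
  proof
    fix g and x y :: "block \<times> block" and a
    obtain x1 x2 x3 x4 y1 y2 y3 y4 where "x = ((x1, x2), (x3, x4))" "y = ((y1, y2), (y3, y4))"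
      by (metis prod.exhaust)
    then show "\<rho> g (x + y) = \<rho> g x + \<rho> g y" "\<rho> g (cscale a x) = cscale a (\<rho> g x)"
      by (cases g rule: gen_cases;
          simp add: block_defs algebra_simps add_divide_distrib)+
  qed
qed

text \<open>On each block \<open>p / (1 - X\<^bsup>-\<alpha>\<^sub>1\<^esup>)\<close> inverts the difference along \<open>\<alpha>\<^sub>1\<close>; the sums telescope as required by
  \<open>linext_demazure\<close>.\<close>

lemma G_telescope:
  "dual A (A * n) (G x) - dual (A * inverse z) (A * inverse z * (n + 1)) (G x)
     = dual p 0 (dual A (A * n) x)"
proof -
  obtain a b where x: "x = (a, b)" by (metis prod.exhaust)
  define y where "y = inverse z"
  have "A * (g0 * a + g1 * b) + A * n * (g0 * b)
      - (A * y * (g0 * a + g1 * b) + A * y * (n + 1) * (g0 * b))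
    = A * a * (g0 - y * g0) + A * b * ((g1 - y * g1) - y * g0) + A * b * n * (g0 - y * g0)"
    by (simp add: algebra_simps)
  also have "\<dots> = p * (A * a + A * n * b)"
    by (simp only: y_def constants(1,2)) (simp add: algebra_simps)
  finally have 1: "A * (g0 * a + g1 * b) + A * n * (g0 * b)
      - (A * y * (g0 * a + g1 * b) + A * y * (n + 1) * (g0 * b)) = p * (A * a + A * n * b)" .
  have "A * (g0 * b) - A * y * (g0 * b) = A * b * (g0 - y * g0)"
    by (simp add: algebra_simps)
  also have "\<dots> = p * (A * b)"
    by (simp only: y_def constants(1)) (simp add: algebra_simps)
  finally show ?thesis
    using 1 by (simp add: x G_def y_def[symmetric])
qed

lemma H_telescope:
  "dual A (A * n) (H x) - dual (A * z) (A * z * (n - 1)) (H x) = dual p 0 (dual A (A * n) x)"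
proof -
  obtain a b where x: "x = (a, b)" by (metis prod.exhaust)
  have "A * (h0 * a - g1 * b) + A * n * (h0 * b)
      - (A * z * (h0 * a - g1 * b) + A * z * (n - 1) * (h0 * b))
    = A * a * (h0 - z * h0) - A * b * ((g1 - z * g1) - z * h0) + A * b * n * (h0 - z * h0)"
    by (simp add: algebra_simps)
  also have "\<dots> = p * (A * a + A * n * b)"
    by (simp only: constants(3,4)) (simp add: algebra_simps)
  finally have 1: "A * (h0 * a - g1 * b) + A * n * (h0 * b)
      - (A * z * (h0 * a - g1 * b) + A * z * (n - 1) * (h0 * b)) = p * (A * a + A * n * b)" .
  have "A * (h0 * b) - A * z * (h0 * b) = A * b * (h0 - z * h0)"
    by (simp add: algebra_simps)
  also have "\<dots> = p * (A * b)"
    by (simp only: constants(3)) (simp add: algebra_simps)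
  finally show ?thesis
    using 1 by (simp add: x H_def)
qed

lemma bernstein_One:
  "\<rho> (GenX \<nu>) (\<rho> (GenT One) e) = \<rho> (GenT One) (\<rho> (GenX (reflection One \<nu>)) e)
      + cscale p (linext (\<lambda>\<mu>. \<rho> (GenX \<mu>) e) (demazure One \<nu>))"
proof -
  obtain x y where e: "e = (x, y)" by (metis prod.exhaust)
  \<comment> \<open>The part of \<open>T\<^sub>1\<close> that commutes with the lattice; the other part exchanges the blocks.\<close>
  define e' where "e' = (G x, H y)"
  define d where "d \<mu> = cscale (inverse p) (\<rho> (GenX \<mu>) e')" for \<mu>
  have "\<rho> (GenX \<mu>) e = d \<mu> - d (\<mu> - simple_root One)" for \<mu>
  proof -
    have n: "of_int (snd (\<mu> - simple_root One)) = of_int (snd \<mu>) + (1 :: complex)"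
      "of_int (fst (\<mu> - simple_root One) + snd (\<mu> - simple_root One))
         = of_int (fst \<mu> + snd \<mu>) - (1 :: complex)"
      by simp_all
    have "\<rho> (GenX \<mu>) e' - \<rho> (GenX (\<mu> - simple_root One)) e' = cscale p (\<rho> (GenX \<mu>) e)"
      unfolding e e'_def \<rho>.simps t_refl_shift n diff_Pair G_telescope H_telescope cscale_simp ..
    then show ?thesis
      using p_nonzero by (simp add: d_def flip: scale_right_diff_distrib)
  qed
  from linext_demazure[where c = "\<lambda>\<mu>. \<rho> (GenX \<mu>) e" and d = d, OF this, of \<nu>]
  have "cscale p (linext (\<lambda>\<mu>. \<rho> (GenX \<mu>) e) (demazure One \<nu>))
      = \<rho> (GenX \<nu>) e' - \<rho> (GenX (reflection One \<nu>)) e'"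
    using p_nonzero by (simp add: d_def scale_right_diff_distrib)
  moreover have "\<rho> (GenT One) e = e' + (K y, x)"
    by (simp add: e e'_def)
  moreover have GH: "G (dual u v x) = dual u v (G x)" "H (dual u v x) = dual u v (H x)" for u v x
    unfolding G_def H_def by (rule dual_commute)+
  then have "K (dual u v x) = dual u v (K x)" for u v x
    by (simp add: K_def dual_add)
  with GH have "\<rho> (GenT One) (\<rho> (GenX (reflection One \<nu>)) e)
      = \<rho> (GenX (reflection One \<nu>)) e' + \<rho> (GenX \<nu>) (K y, x)"
    by (simp add: e e'_def reflection_involution) (simp add: reflection_simps)
  ultimately show ?thesis
    by (simp add: gen_add)
qed

lemma bernstein_Two:
  "\<rho> (GenX \<nu>) (\<rho> (GenT Two) e) = \<rho> (GenT Two) (\<rho> (GenX (reflection Two \<nu>)) e)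
      + cscale p (linext (\<lambda>\<mu>. \<rho> (GenX \<mu>) e) (demazure Two \<nu>))"
proof -
  obtain x y where e: "e = (x, y)" by (metis prod.exhaust)
  \<comment> \<open>On the second block \<open>1 - X\<^bsup>-\<alpha>\<^sub>2\<^esup>\<close> is the scalar \<open>1 - q\<^bsup>-2\<^esup>\<close>. On the first block it is nilpotent, and a
    quadratic polynomial in \<open>n\<close> is needed to have the linear polynomial \<open>1 + n N\<close> as its difference
    with step two.\<close>
  define c where "c = 1 / (1 - inverse (q * q))"
  define d :: "weight \<Rightarrow> block \<times> block" where "d \<mu> = (let n = of_int (snd \<mu>) in
      (dual (t \<mu> * (n / 2)) (t \<mu> * (n * n / 4 + n / 2)) x,
       dual (t (reflection One \<mu>) * c) (t (reflection One \<mu>) * c * of_int (fst \<mu> + snd \<mu>)) y))"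
    for \<mu>
  have nz: "1 - inverse (q * q) \<noteq> 0"
    using q_sq(1) by (metis eq_iff_diff_eq_0 inverse_eq_1_iff)
  have "q * (1 - inverse (q * q)) = p"
    using q0 by (simp add: p_def right_diff_distrib)
  then have pc: "p * c = q"
    using nz by (simp add: c_def flip: \<open>_ = p\<close>)
  from nz have c1: "c * (1 - inverse (q * q)) = 1"
    by (simp add: c_def)
  have "(A - A * r) * c = A * (c * (1 - r))" for A r
    by (simp add: algebra_simps)
  then have c: "(A - A * inverse (q * q)) * c = A" for A
    by (simp only: c1 mult_1_right)
  have diff: "dual u v x - dual u' v' x = dual (u - u') (v - v') x" for u v u' v' x
    by (cases x) (simp add: algebra_simps)
  have "\<rho> (GenX \<mu>) e = d \<mu> - d (\<mu> - simple_root Two)" for \<mu>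
  proof -
    have n: "of_int (snd (\<mu> - simple_root Two)) = of_int (snd \<mu>) - (2 :: complex)"
      "fst (\<mu> - simple_root Two) + snd (\<mu> - simple_root Two) = fst \<mu> + snd \<mu>"
      by simp_all
    have "t \<mu> * (n / 2) - t \<mu> * ((n - 2) / 2) = t \<mu>"
      "t \<mu> * (n * n / 4 + n / 2) - t \<mu> * ((n - 2) * (n - 2) / 4 + (n - 2) / 2) = t \<mu> * n" for n
      by (simp_all add: field_simps)
    then show ?thesis
      unfolding e d_def Let_def n t_refl_shift diff_Pair diff left_diff_distrib[symmetric] c
      by simp
  qed
  from linext_demazure[where c = "\<lambda>\<mu>. \<rho> (GenX \<mu>) e" and d = d, OF this, of \<nu>]
  have D: "linext (\<lambda>\<mu>. \<rho> (GenX \<mu>) e) (demazure Two \<nu>) = d \<nu> - d (reflection Two \<nu>)" .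
  have U: "dual A (A * n) (U x) = U (dual A (A * - n) x) + dual p 0
      (dual (A * (n / 2)) (A * (n * n / 4 + n / 2)) x
       - dual (A * (- n / 2)) (A * (- n * - n / 4 + - n / 2)) x)" for A n
  proof -
    have "A * (n / 2) - A * (- n / 2) = A * n"
      "A * (n * n / 4 + n / 2) - A * (- n * - n / 4 + - n / 2) = A * n"
      by (simp_all add: field_simps)
    then show ?thesis
      unfolding diff using p_nonzero by (cases x) (simp add: algebra_simps add_divide_distrib)
  qed
  have q: "dual A (A * m) (dual q 0 y) = dual q 0 (dual B (B * m) y)
      + dual p 0 (dual (A * c) (A * c * m) y - dual (B * c) (B * c * m) y)" for A B m
  proof -
    have "p * (A * (c * w)) = (p * c) * (A * w)" for A w
      by (simp add: ac_simps)
    then have "p * (A * (c * w)) = q * (A * w)" for A w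
      by (simp only: pc)
    note pcw = this
    show ?thesis
      unfolding diff
      by (cases y) (simp add: right_diff_distrib left_diff_distrib distrib_left mult.assoc pcw)
  qed
  have n: "of_int (snd (reflection Two \<nu>)) = - (of_int (snd \<nu>) :: complex)"
    "fst (reflection Two \<nu>) + snd (reflection Two \<nu>) = fst \<nu> + snd \<nu>"
    by (simp_all add: reflection_simps)
  show ?thesis
    unfolding D unfolding e d_def Let_def \<rho>.simps n t_reflection2 diff_Pair cscale_simp add_Pair
    by (intro arg_cong2[where f = Pair] U q)
qed

lemma quadratic_T: "\<rho> (GenT i) (\<rho> (GenT i) e) = cscale p (\<rho> (GenT i) e) + e"
proof -
  obtain a1 a2 b1 b2 where e: "e = ((a1, a2), (b1, b2))" by (metis prod.exhaust)
  have "q * q = p * q + 1"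
    using q0 by (simp add: p_def algebra_simps)
  then show ?thesis
    using p_nonzero
    by (cases i; simp add: e block_defs h0_def algebra_simps)
qed

text \<open>In terms of \<open>T\<^sub>1\<close> and \<open>T\<^sub>2\<close> this is the component of the braid relation that maps the first block to the second one,
  with \<open>H\<close> replaced by \<open>p - G\<close>. The other components follow from it formally. It depends on
  \<open>z\<^sup>2 = q\<^sup>2\<close> through the values of \<open>g0\<close> and \<open>g1\<close>.\<close>

lemma UGU:
  "U (G (U x)) = dual q 0 (U (G x)) + dual q 0 (G (U x)) + dual q 0 (dual q 0 (dual p 0 x))
     - dual q 0 (dual q 0 (G x)) - dual q 0 (dual p 0 (U x))"
proof -
  obtain a b where x: "x = (a, b)" by (metis prod.exhaust)
  have pq: "q * q = p * q + 1"
    using q0 by (simp add: p_def algebra_simps)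
  have ee: "\<epsilon> * \<epsilon> = 1" "\<epsilon> * (\<epsilon> * x) = x" for x
    using q_sq(5) by (simp_all flip: mult.assoc)
  have "(q * q - 1) * g1 = (q + \<epsilon>) * ((q - \<epsilon>) * g1)"
    by (simp add: algebra_simps ee)
  also have "(q - \<epsilon>) * g1 = \<epsilon> * q + 1"
    using q_sq(4) by (simp add: g1_def)
  finally have g1: "(q * q - 1) * g1 = \<epsilon> * (q * q) + 2 * q + \<epsilon>"
    by (simp add: algebra_simps ee)
  have pq': "q * p = q * q - 1"
    using pq by (simp add: algebra_simps)
  have 1: "g0 * (1 + q * q) = q * p * (g1 + q)"
    unfolding pq' distrib_left g1 by (simp add: g0_def algebra_simps)
  have "q * (p * (g0 + g1 + q)) = (q * q - 1) * (g0 + q) + (q * q - 1) * g1"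
    unfolding pq'[symmetric] by (simp add: algebra_simps)
  also have "\<dots> = q * (2 * q * g0)"
    unfolding g1 by (simp add: g0_def algebra_simps)
  finally have 2: "p * (g0 + g1 + q) = 2 * q * g0"
    using q0 by simp
  obtain r where r: "inverse p = r" "r * p = 1"
    using p_nonzero by simp
  have g0: "q * g1 * p + q * q * p - q * q * g0 = g0"
    using 1 by (simp add: algebra_simps)
  have "2 * q * g0 * r = (g0 + g1 + q) * (r * p)"
    unfolding 2[symmetric] by (simp add: algebra_simps)
  then have g01: "2 * q * g0 * r = g0 + g1 + q"
    by (simp add: r(2))
  have top: "g0 * (p * a + p * b) * r = q * (g0 * b * r) + q * (g0 * (b * r) + g1 * (p * a + p * b))
      + q * (q * (p * a)) - q * (q * (g0 * a + g1 * b)) - q * (p * (b * r))"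
  proof -
    have "q * (g0 * b * r) + q * (g0 * (b * r) + g1 * (p * a + p * b))
        + q * (q * (p * a)) - q * (q * (g0 * a + g1 * b)) - q * (p * (b * r))
      = a * (q * g1 * p + q * q * p - q * q * g0)
        + b * (2 * q * g0 * r + g1 * (q * p - q * q) - q * (r * p))"
      by (simp add: algebra_simps)
    also have "\<dots> = g0 * (a + b)"
      by (simp only: g0 g01 pq' r(2)) (simp add: algebra_simps)
    also have "\<dots> = g0 * (a + b) * (r * p)"
      by (simp only: r(2) mult_1_right)
    finally show ?thesis by (simp add: algebra_simps)
  qed
  have bottom: "p * (g0 * (b * r) + g1 * (p * a + p * b)) + p * (g0 * (p * a + p * b))
      = q * (p * (g0 * a + g1 * b) + p * (g0 * b)) + q * (g0 * (p * a + p * b))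
        + q * (q * (p * b)) - q * (q * (g0 * b)) - q * (p * (p * a + p * b))"
  proof -
    have "p * (g0 * (b * r) + g1 * (p * a + p * b)) + p * (g0 * (p * a + p * b))
      = (r * p) * g0 * b + p * (p * (g0 + g1 + q)) * (a + b) - p * q * p * (a + b)"
      by (simp add: algebra_simps)
    also have "\<dots> = (q * g1 * p + q * q * p - q * q * g0) * b + p * (2 * q * g0) * (a + b)
        - p * q * p * (a + b)"
      by (simp only: g0 2 r(2) mult_1_left)
    finally show ?thesis by (simp add: algebra_simps)
  qed
  show ?thesis
    using top bottom by (simp add: x block_defs divide_inverse r(1))
qed

lemma braid_T:
  "\<rho> (GenT One) (\<rho> (GenT Two) (\<rho> (GenT One) (\<rho> (GenT Two) e)))
      = \<rho> (GenT Two) (\<rho> (GenT One) (\<rho> (GenT Two) (\<rho> (GenT One) e)))"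
proof -
  obtain x y where e: "e = (x, y)" by (metis prod.exhaust)
  have H: "H x = dual p 0 x - G x" for x
    by (cases x) (simp add: G_def H_def h0_def algebra_simps)
  have add: "G (x + y) = G x + G y" "G (x - y) = G x - G y" "U (x + y) = U x + U y"
    "U (x - y) = U x - U y" "dual c 0 (x + y) = dual c 0 x + dual c 0 y"
    "dual c 0 (x - y) = dual c 0 x - dual c 0 y" for x y c
    by (cases x; cases y; simp add: G_def algebra_simps diff_divide_distrib add_divide_distrib)+
  have scalar: "G (dual c 0 x) = dual c 0 (G x)" "U (dual c 0 x) = dual c 0 (U x)"
    "dual p 0 (dual q 0 x) = dual q 0 (dual p 0 x)" for c x
    by (cases x; simp add: G_def algebra_simps)+
  show ?thesis
    by (simp add: e K_def H add scalar UGU)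
qed

lemma bernstein_T:
  "\<rho> (GenX \<nu>) (\<rho> (GenT i) e) = \<rho> (GenT i) (\<rho> (GenX (reflection i \<nu>)) e)
      + cscale p (linext (\<lambda>\<mu>. \<rho> (GenX \<mu>) e) (demazure i \<nu>))"
  using bernstein_One bernstein_Two by (cases i) simp_all

sublocale hecke_representation cscale \<rho> q
proof
  fix \<nu> \<mu> :: weight and e :: "block \<times> block"
  show "\<rho> (GenX 0) e = e"
  proof -
    obtain a1 a2 b1 b2 where "e = ((a1, a2), (b1, b2))" by (metis prod.exhaust)
    then show ?thesis
      by (simp add: reflection_simps t_simps flip: zero_prod_def)
  qed
  show "\<rho> (GenX (\<nu> + \<mu>)) e = \<rho> (GenX \<nu>) (\<rho> (GenX \<mu>) e)"
  proof -
    obtain x y where e: "e = (x, y)" by (metis prod.exhaust)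
    have "dual (a * b) (a * b * (k + l)) x = dual a (a * k) (dual b (b * l) x)" for a b k l x
      by (cases x) (simp add: algebra_simps)
    moreover have "of_int (snd (\<nu> + \<mu>)) = (of_int (snd \<nu>) + of_int (snd \<mu>) :: complex)"
      "of_int (fst (\<nu> + \<mu>) + snd (\<nu> + \<mu>))
         = (of_int (fst \<nu> + snd \<nu>) + of_int (fst \<mu> + snd \<mu>) :: complex)"
      by simp_all
    ultimately show ?thesis
      by (simp only: e \<rho>.simps reflection_add t_simps(2))
  qed
qed (use quadratic_T braid_T bernstein_T in \<open>simp_all add: p_def\<close>)

text \<open>The eigenvector of weight \<open>s\<^sub>1 t\<close> that is the image of the generator of the induced module.\<close>

definition v :: "block \<times> block" where
  "v = ((0, 0), (1, 0))"

sublocale weight_vector cscale \<rho> q v Two q "t \<circ> reflection One"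
  by standard (simp_all add: v_def zero_prod_def)

text \<open>The element \<open>X\<^bsup>\<omega>\<^sub>1\<^esup>\<close> is a scalar on the first block and a different scalar plus a nonzero multiple of
  \<open>N\<close> on the second one. Subtracting suitable scalars therefore kills first the first block and then everything but
  \<open>v\<close>, provided that there is a component in the second block; otherwise \<open>T\<^sub>1\<close> creates one.\<close>

lemma reaches_v:
  assumes "e \<noteq> 0"
  shows "\<exists>h. act h e = v"
proof -
  obtain x y where e: "e = (x, y)" by (metis prod.exhaust)
  have step: "\<exists>h. act h e = v" if "act g e = e'" "\<exists>h. act h e' = v" for g e e'
    using that by (metis act_mult)
  let ?\<omega> = "(1, 0) :: weight"
  have u: "t ?\<omega> * inverse z = t (reflection One ?\<omega>)"
  proof -
    have "reflection One ?\<omega> = ?\<omega> - simple_root One"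
      by (simp add: reflection_simps)
    then show ?thesis by (simp only: t_refl_shift)
  qed
  have "z \<noteq> 1"
    using q_sq(2,3) eps by (auto simp: z_def minus_equation_iff[of q])
  then have u_neq: "t (reflection One ?\<omega>) \<noteq> t ?\<omega>"
    using t_simps(3)[of ?\<omega>] unfolding u[symmetric] by simp
  have line: "\<exists>h. act h (0, (b, 0)) = v" if "b \<noteq> 0" for b
    using that by (intro exI[of _ "scalar (inverse b)"]) (simp add: v_def zero_prod_def)
  have bottom: "\<exists>h. act h (0, y) = v" if "y \<noteq> 0" for y
  proof -
    obtain a b where y: "y = (a, b)" by (metis prod.exhaust)
    show ?thesis
    proof (cases "b = 0")
      case True
      then show ?thesis using line that by (simp add: y zero_prod_def)
    next
      case False
      let ?g = "tX ?\<omega> - scalar (t (reflection One ?\<omega>))"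
      have "act ?g (0, y) = (0, (t (reflection One ?\<omega>) * b, 0))"
        by (simp add: y zero_prod_def algebra_simps)
      then show ?thesis
        by (rule step) (use False t_simps(3) in \<open>simp add: line del: split_paired_All\<close>)
    qed
  qed
  have nonzero: "\<exists>h. act h (x, y) = v" if "y \<noteq> 0" for x y
  proof -
    obtain x1 x2 y1 y2 where xy: "x = (x1, x2)" "y = (y1, y2)" by (metis prod.exhaust)
    let ?g = "tX ?\<omega> - scalar (t ?\<omega>)"
    let ?u = "t (reflection One ?\<omega>)"
    have "act ?g (x, y) = (0, ((?u - t ?\<omega>) * y1 + ?u * y2, (?u - t ?\<omega>) * y2))"
      by (simp add: xy zero_prod_def algebra_simps)
    then show ?thesis
    proof (rule step)
      show "\<exists>h. act h (0, ((?u - t ?\<omega>) * y1 + ?u * y2, (?u - t ?\<omega>) * y2)) = v"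
        using that u_neq by (intro bottom) (auto simp: xy zero_prod_def)
    qed
  qed
  show ?thesis
  proof (cases "y = 0")
    case False
    then show ?thesis unfolding e by (rule nonzero)
  next
    case True
    have "act (tT One) e = (G x, x)"
      by (simp add: e True block_defs zero_prod_def)
    then show ?thesis
      by (rule step) (use assms True in \<open>simp add: e nonzero zero_prod_def\<close>)
  qed
qed

text \<open>The four spanning words are sent to linearly independent vectors when applied to \<open>v\<close>, since \<open>T\<^sub>1\<close>
  moves \<open>v\<close> to the first block with the nonzero coefficient \<open>k\<close>, and \<open>T\<^sub>2\<close> and \<open>T\<^sub>1\<close> reach the remaining two
  basis vectors from there.\<close>

lemma annihilator_v:
  assumes J: "inducing_left_ideal q Two q (t \<circ> reflection One) J" and x: "act x v = 0"
  shows "x \<in> J"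
proof -
  \<comment> \<open>Intersecting with the annihilator of \<open>v\<close> makes the remainder of the expansion act as zero on \<open>v\<close>.\<close>
  have "inducing_left_ideal q Two q (t \<circ> reflection One) (J \<inter> {x. act x v = 0})"
    using J unfolding inducing_left_ideal_def
    by (auto simp: act_hecke_ideal act_right_0 T_v X_v simp del: split_paired_All)
  from inducing_left_ideal_span[OF this, of x] obtain c0 c1 c2 c3 b where
    b_def: "b = scalar c0 + scalar c1 * tT One + scalar c2 * (tT Two * tT One)
      + scalar c3 * (tT One * (tT Two * tT One))"
    and b: "x - b \<in> J" "act (x - b) v = 0"
    by blast
  define k where "k = 1 + g0 * h0"
  have k: "k \<noteq> 0" using k0_nonzero by (simp add: k_def)
  have T1: "\<rho> (GenT One) v = ((k, 0), (h0, 0))"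
    by (simp add: v_def K_simp block_defs k_def)
  have T2: "\<rho> (GenT Two) ((k, 0), (h0, 0)) = ((0, p * k), (q * h0, 0))"
    by simp
  have T3: "\<rho> (GenT One) ((0, p * k), (q * h0, 0))
      = ((g1 * (p * k) + k * (q * h0), g0 * (p * k)), (h0 * (q * h0), p * k))"
    by (simp add: K_simp G_def H_def k_def)
  have "act b v = 0"
    using b(2) x by simp
  then have eqs: "c3 * (p * k) = 0" "c2 * (p * k) + c3 * (g0 * (p * k)) = 0"
    "c1 * k + c3 * (g1 * (p * k) + k * (q * h0)) = 0"
    "c0 + (c1 * h0 + c2 * (q * h0) + c3 * (h0 * (q * h0))) = 0"
    unfolding b_def act_left act_mult act_scalar act_gen T1 T2 T3
    by (simp_all add: v_def zero_prod_def add.assoc)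
  have "c3 = 0" using eqs(1) k p_nonzero by simp
  then have "c2 = 0" using eqs(2) k p_nonzero by simp
  then have "c1 = 0" using eqs(3) k \<open>c3 = 0\<close> by simp
  then have "c0 = 0" using eqs(4) \<open>c2 = 0\<close> \<open>c3 = 0\<close> by simp
  show ?thesis
    using b(1) by (simp add: b_def \<open>c0 = 0\<close> \<open>c1 = 0\<close> \<open>c2 = 0\<close> \<open>c3 = 0\<close> scalar_simps)
qed

lemma irreducible:
  "irreducible_module (hecke q)
     (induced_module (hecke q) (hecke_sub q Two) (one_dim_module q Two q (t \<circ> reflection One)))"
  using irreducible_induced[OF reaches_v annihilator_v] by (simp add: V_def)

end

section \<open>The two induced modules\<close>

text \<open>The relations involve \<open>q\<close> only through \<open>q - q\<^bsup>-1\<^esup>\<close>.\<close>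

lemma hecke_minus_inverse:
  fixes q :: complex
  assumes "q \<noteq> 0"
  shows "hecke (- inverse q) = hecke q" "hecke_sub (- inverse q) i = hecke_sub q i"
    "one_dim_module (- inverse q) i = one_dim_module q i"
proof -
  have "hecke_relators (- inverse q) = hecke_relators q"
    using assms by (simp add: hecke_relators_def)
  then have ideal: "hecke_ideal (- inverse q) = hecke_ideal q"
    by (simp add: hecke_ideal_def)
  then have cls: "cls (- inverse q) = cls q"
    by (simp add: cls_def fun_eq_iff)
  show hecke: "hecke (- inverse q) = hecke q"
    by (simp add: hecke_def ideal)
  show sub: "hecke_sub (- inverse q) i = hecke_sub q i"
    by (simp add: hecke_sub_def hecke cls)
  show "one_dim_module (- inverse q) i = one_dim_module q i"
    by (simp add: one_dim_module_def is_one_dim_module_def hecke sub cls fun_eq_iff)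
qed

lemma weyl_act_reflection: "weyl_act (reflection i) t = t \<circ> reflection i"
proof -
  have "Hilbert_Choice.inv (reflection i) = reflection i"
    by (rule inv_unique_comp) (auto simp: reflection_involution)
  then show ?thesis by (simp add: weyl_act_def o_def)
qed

lemma weyl_act_comp:
  "weyl_act (reflection i \<circ> reflection j) t = t \<circ> reflection j \<circ> reflection i"
proof -
  have "Hilbert_Choice.inv (reflection i \<circ> reflection j) = reflection j \<circ> reflection i"
    by (rule inv_unique_comp) (auto simp: reflection_involution fun_eq_iff)
  then show ?thesis by (simp add: weyl_act_def o_def)
qed

lemma cube_neq:
  fixes q :: complex
  assumes "q\<^sup>2 \<noteq> 1" "\<epsilon> \<in> {1, -1}"
    and "\<not> (\<epsilon> = -1 \<and> primitive_root_of_unity 6 q \<or> \<epsilon> = 1 \<and> primitive_root_of_unity 3 q)"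
  shows "q ^ 3 \<noteq> \<epsilon>"
proof
  assume q3: "q ^ 3 = \<epsilon>"
  have q1: "q \<noteq> 1" "q \<noteq> - 1"
    using assms(1) by auto
  show False
  proof (cases "\<epsilon> = 1")
    case True
    have "q ^ k \<noteq> 1" if "0 < k" "k < 3" for k
    proof -
      have "k = 1 \<or> k = 2" using that by auto
      then show ?thesis using q1 assms(1) by auto
    qed
    then show False
      using assms(3) True q3 by (simp add: primitive_root_of_unity_def)
  next
    case False
    then have eps: "\<epsilon> = - 1" using assms(2) by auto
    have q4: "q ^ 4 = - q" and q5: "q ^ 5 = - (q ^ 2)" and q6: "q ^ 6 = 1"
      using q3 eps power_add[of q 3 1] power_add[of q 3 2] power_add[of q 3 3] by simp_all
    have "q ^ 2 \<noteq> - 1"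
    proof
      assume "q ^ 2 = - 1"
      then have "q ^ 3 = - q" using power_add[of q 2 1] by simp
      then show False using q3 eps q1 by simp
    qed
    then have q52: "- (q ^ 2) \<noteq> 1"
      by (metis minus_minus)
    have q41: "- q \<noteq> 1" using q1 by (metis minus_minus)
    have "q ^ k \<noteq> 1" if "0 < k" "k < 6" for k
    proof -
      have "k = 1 \<or> k = 2 \<or> k = 3 \<or> k = 4 \<or> k = 5" using that by auto
      then show ?thesis using q1 assms(1) q3 eps q4 q5 q41 q52 by auto
    qed
    then show False
      using assms(3) eps q6 by (simp add: primitive_root_of_unity_def)
  qed
qed

theorem proposition21:
  fixes q \<epsilon> :: complex and t :: "weight \<Rightarrow> complex"
  assumes "q \<noteq> 0" and "q\<^sup>2 \<noteq> 1"
    and "\<epsilon> \<in> {1, -1}"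
    and "is_character t" and "restricts_on_roots t (\<epsilon> * q) 1"
    and "\<not> (\<epsilon> = -1 \<and> primitive_root_of_unity 6 q \<or> \<epsilon> = 1 \<and> primitive_root_of_unity 3 q)"
  shows
    "irreducible_module (hecke q)
       (induced_module (hecke q) (hecke_sub q Two)
         (one_dim_module q Two q (weyl_act (reflection One) t)))
     \<and> irreducible_module (hecke q)
       (induced_module (hecke q) (hecke_sub q Two)
         (one_dim_module q Two (- inverse q) (weyl_act (reflection Two \<circ> reflection One) t)))"
proof -
  have roots: "t (simple_root One) = \<epsilon> * q" "t (simple_root Two) = 1"
    using assms(5)[unfolded restricts_on_roots_def, rule_format, of 1 0]
      assms(5)[unfolded restricts_on_roots_def, rule_format, of 0 1]
    by (simp_all add: zmul_def)
  have q3: "q ^ 3 \<noteq> \<epsilon>"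
    using assms by (intro cube_neq)
  interpret M: special_weight q \<epsilon> t
    using assms roots q3 by unfold_locales auto
  \<comment> \<open>The second module is the first one for \<open>-q\<^bsup>-1\<^esup>\<close>, \<open>-\<epsilon>\<close> and the weight \<open>u = s\<^sub>1 s\<^sub>2 s\<^sub>1 t\<close>, for which
    \<open>s\<^sub>1 u = s\<^sub>2 s\<^sub>1 t\<close>.\<close>
  define q' where "q' = - inverse q"
  define u where "u = t \<circ> reflection One \<circ> reflection Two \<circ> reflection One"
  have "u (simple_root One) = t (- (simple_root One + simple_root Two))"
    by (simp add: u_def reflection_simps)
  also have "\<dots> = - \<epsilon> * q'"
    using assms(3) by (simp only: M.t_simps roots) (auto simp: q'_def)
  finally have u1: "u (simple_root One) = - \<epsilon> * q'" .
  have "u (simple_root Two) = t (simple_root Two)"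
    by (simp add: u_def reflection_simps)
  then have u2: "u (simple_root Two) = 1"
    by (simp only: roots)
  have "q' ^ 3 \<noteq> - \<epsilon>"
  proof
    assume "q' ^ 3 = - \<epsilon>"
    then have "inverse (q ^ 3) = \<epsilon>"
      by (simp add: q'_def power_inverse)
    then have "q ^ 3 = inverse \<epsilon>"
      by (metis inverse_inverse_eq)
    then show False
      using q3 assms(3) by auto
  qed
  moreover have "q'\<^sup>2 \<noteq> 1" "q' \<noteq> 0"
    using assms(1,2) by (auto simp: q'_def power_inverse)
  moreover have "is_character u"
    using M.t_simps(2,3) by (simp add: is_character_def u_def reflection_add)
  ultimately interpret N: special_weight q' "- \<epsilon>" u
    using assms(3) u1 u2 by unfold_locales auto
  have "u \<circ> reflection One = t \<circ> reflection One \<circ> reflection Two"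
    by (simp add: u_def fun_eq_iff reflection_involution del: split_paired_All)
  with N.irreducible have "irreducible_module (hecke q)
       (induced_module (hecke q) (hecke_sub q Two)
         (one_dim_module q Two (- inverse q) (t \<circ> reflection One \<circ> reflection Two)))"
    using assms(1) by (simp add: q'_def hecke_minus_inverse)
  with M.irreducible show ?thesis
    by (simp add: weyl_act_reflection weyl_act_comp)
qed

end
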